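(* For every $n\ge2$, the $n$th monic Jacobi–Sobolev orthogonal polynomial $S_n$ is a solution of the second-order linear differential equation with polynomial coefficients $$\mathfrak P_{2,n}(x)S_n''(x)+\mathfrak P_{1,n}(x)S_n'(x)+\mathfrak P_{0,n}(x)S_n(x)=0,$$ where $$\begin{aligned} \mathfrak P_{2,n}&=q_{1,n}\,q_{0,n}^2,\\ \mathfrak P_{1,n}&=q_{0,n}\left(q_{1,n}q_{2,n}+q_{1,n}q_{3,n}+q_{0,n}'q_{1,n}-q_{0,n}q_{1,n}'\right),\\ \mathfrak P_{0,n}&=q_{1,n}q_{2,n}q_{3,n}+q_{0,n}\left(q_{2,n}'q_{1,n}-q_{2,n}q_{1,n}'\right)-q_{4,n}q_{1,n}^2, \end{aligned}$$ and $\deg\mathfrak P_{2,n}=6d+4$, $\deg\mathfrak P_{1,n}\le6d+3$, $\deg\mathfrak P_{0,n}\le6d+2$.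
   Context: Let $\alpha,\beta>-1$, $d\mu^{\alpha,\beta}(x)=(1-x)^\alpha(1+x)^\beta dx$ on $[-1,1]$; let $P_n=P_n^{\alpha,\beta}$ be the monic Jacobi polynomials and $h_n=\int_{-1}^1P_n^2\,d\mu^{\alpha,\beta}$. Let $N,d_j$ be nonnegative integers, $\lambda_{j,k}\ge0$ for $1\le j\le N$, $0\le k\le d_j$, $c_1,\dots,c_N\in\mathbb R\setminus(-1,1)$ distinct, $I_+=\{(j,k):\lambda_{j,k}>0\}$; assume $(j,d_j)\in I_+$ for all $j$ and $d_1\le\dots\le d_N$. Put $d=\sum_{j=1}^N(d_j+1)$. $S_n$ is the monic polynomial of degree $n$ with $\langle x^i,S_n\rangle_{\mathsf s}=0$ for $0\le i<n$, where $$\langle f,g\rangle_{\mathsf s}=\int_{-1}^1fg\,d\mu^{\alpha,\beta}+\sum_{(j,k)\in I_+}\lambda_{j,k}f^{(k)}(c_j)g^{(k)}(c_j).$$ Notation. $Q_k(x,y;f)=\sum_{\nu=0}^k\frac{f^{(\nu)}(y)}{\nu!}(x-y)^\nu$; $\rho(x)=\prod_{j=1}^N(x-c_j)^{d_j+1}$; $\rho_{j,k}(x)=\rho(x)/(x-c_j)^{k+1}$. $$\gamma_{1,n}=\frac{\beta^2-\alpha^2}{(2n+\alpha+\beta)(2n+\alpha+\beta+2)},\quad \gamma_{2,n}=\frac{4n(n+\alpha)(n+\beta)(n+\alpha+\beta)}{(2n+\alpha+\beta)^2((2n+\alpha+\beta)^2-1)},$$ $$\widehat a_n(x)=-\frac{n((2n+\alpha+\beta)x+\beta-\alpha)}{2n+\alpha+\beta},\quad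 \widehat b_n=\frac{4n(n+\alpha)(n+\beta)(n+\alpha+\beta)}{(2n+\alpha+\beta)^2(2n+\alpha+\beta-1)},$$ $$\widehat c_n(x)=\frac{(n+\alpha+\beta)((2n+\alpha+\beta)x+\alpha-\beta)}{2n+\alpha+\beta},\quad \widehat d_n=-(2n+\alpha+\beta-1).$$ (For $n=1$ the common factor $1+\alpha+\beta$ in $\gamma_{2,1}$ and $\widehat b_1$ is cancelled, so these are defined also if $\alpha+\beta=-1$.) For $n\ge1$: $$A_{2,n}(x)=\rho(x)-\sum_{(j,k)\in I_+}\frac{k!\lambda_{j,k}S_n^{(k)}(c_j)}{h_{n-1}}Q_k(x,c_j;P_{n-1})\rho_{j,k}(x),\quad B_{2,n}(x)=\sum_{(j,k)\in I_+}\frac{k!\lambda_{j,k}S_n^{(k)}(c_j)}{h_{n-1}}Q_k(x,c_j;P_n)\rho_{j,k}(x),$$ $$A_{3,n}=(1-x^2)A_{2,n}'+\widehat a_nA_{2,n}+\widehat d_nB_{2,n},\quad B_{3,n}=(1-x^2)B_{2,n}'+\widehat b_nA_{2,n}+\widehat c_nB_{2,n}.$$ For $n\ge2$ and $i\in\{2,3\}$: $$C_{i,n}=-\frac{B_{i,n-1}}{\gamma_{2,n-1}},\quad D_{i,n}=A_{i,n-1}+B_{i,n-1}\frac{x-\gamma_{1,n-1}}{\gamma_{2,n-1}}.$$ $\Delta_n=A_{2,n}D_{2,n}-C_{2,n}B_{2,n}$, $\delta_n=\Delta_n/\rho$ (a polynomial of degree $d$, since $\rho$ divides $\Delta_n$),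 and $$q_{0,n}=(1-x^2)\Delta_n,\quad q_{1,n}=B_{3,n}A_{2,n}-A_{3,n}B_{2,n},\quad q_{2,n}=(1-x^2)\rho'\delta_n+B_{3,n}C_{2,n}-A_{3,n}D_{2,n},$$ $$q_{3,n}=(1-x^2)\rho'\delta_n+C_{3,n}B_{2,n}-D_{3,n}A_{2,n},\quad q_{4,n}=C_{3,n}D_{2,n}-D_{3,n}C_{2,n}.$$ *)

theory Defs
  imports "HOL-Analysis.Analysis" "HOL-Computational_Algebra.Polynomial"
begin

(* At the endpoints "powr" may differ from the convention 0^0 = 1; the endpoints form a null set. *)
definition jacobi_measure :: "real \<Rightarrow> real \<Rightarrow> real measure" where
  "jacobi_measure \<alpha> \<beta> =
     density lborel (\<lambda>x. ennreal (indicator {-1..1} x * ((1 - x) powr \<alpha> * (1 + x) powr \<beta>)))"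

definition jacobi_ip :: "real \<Rightarrow> real \<Rightarrow> real poly \<Rightarrow> real poly \<Rightarrow> real" where
  "jacobi_ip \<alpha> \<beta> f g = (\<integral>x. poly f x * poly g x \<partial>jacobi_measure \<alpha> \<beta>)"

definition monic_orth_poly :: "(real poly \<Rightarrow> real poly \<Rightarrow> real) \<Rightarrow> nat \<Rightarrow> real poly" where
  "monic_orth_poly ip n =
     (THE p. degree p = n \<and> lead_coeff p = 1 \<and> (\<forall>i<n. ip (monom 1 i) p = 0))"

definition jacobi_poly :: "real \<Rightarrow> real \<Rightarrow> nat \<Rightarrow> real poly" where
  "jacobi_poly \<alpha> \<beta> n = monic_orth_poly (jacobi_ip \<alpha> \<beta>) n"

definition jacobi_h :: "real \<Rightarrow> real \<Rightarrow> nat \<Rightarrow> real" where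
  "jacobi_h \<alpha> \<beta> n = (\<integral>x. (poly (jacobi_poly \<alpha> \<beta> n) x)\<^sup>2 \<partial>jacobi_measure \<alpha> \<beta>)"

(* For n = 1 the common factor 1 + \<alpha> + \<beta> of numerator and denominator is cancelled
   in gamma2 and b_hat, so that these are also correct when \<alpha> + \<beta> = -1. *)

definition gamma1 :: "real \<Rightarrow> real \<Rightarrow> nat \<Rightarrow> real" where
  "gamma1 \<alpha> \<beta> n =
     (\<beta>\<^sup>2 - \<alpha>\<^sup>2) / ((2 * real n + \<alpha> + \<beta>) * (2 * real n + \<alpha> + \<beta> + 2))"

definition gamma2 :: "real \<Rightarrow> real \<Rightarrow> nat \<Rightarrow> real" where
  "gamma2 \<alpha> \<beta> n =
     (if n = 1 then 4 * (1 + \<alpha>) * (1 + \<beta>) / ((2 + \<alpha> + \<beta>)\<^sup>2 * (3 + \<alpha> + \<beta>))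
      else 4 * real n * (real n + \<alpha>) * (real n + \<beta>) * (real n + \<alpha> + \<beta>) /
             ((2 * real n + \<alpha> + \<beta>)\<^sup>2 * ((2 * real n + \<alpha> + \<beta>)\<^sup>2 - 1)))"

definition a_hat :: "real \<Rightarrow> real \<Rightarrow> nat \<Rightarrow> real poly" where
  "a_hat \<alpha> \<beta> n =
     smult (- (real n / (2 * real n + \<alpha> + \<beta>))) [:\<beta> - \<alpha>, 2 * real n + \<alpha> + \<beta>:]"

definition b_hat :: "real \<Rightarrow> real \<Rightarrow> nat \<Rightarrow> real" where
  "b_hat \<alpha> \<beta> n =
     (if n = 1 then 4 * (1 + \<alpha>) * (1 + \<beta>) / (2 + \<alpha> + \<beta>)\<^sup>2
      else 4 * real n * (real n + \<alpha>) * (real n + \<beta>) * (real n + \<alpha> + \<beta>) /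
             ((2 * real n + \<alpha> + \<beta>)\<^sup>2 * (2 * real n + \<alpha> + \<beta> - 1)))"

definition c_hat :: "real \<Rightarrow> real \<Rightarrow> nat \<Rightarrow> real poly" where
  "c_hat \<alpha> \<beta> n =
     smult ((real n + \<alpha> + \<beta>) / (2 * real n + \<alpha> + \<beta>)) [:\<alpha> - \<beta>, 2 * real n + \<alpha> + \<beta>:]"

definition d_hat :: "real \<Rightarrow> real \<Rightarrow> nat \<Rightarrow> real" where
  "d_hat \<alpha> \<beta> n = - (2 * real n + \<alpha> + \<beta> - 1)"

(* The Taylor polynomial Q_k(x, y; f), as a polynomial in x. *)
definition taylor_Q :: "nat \<Rightarrow> real \<Rightarrow> real poly \<Rightarrow> real poly" where
  "taylor_Q k y f = (\<Sum>\<nu>\<le>k. smult (poly ((pderiv ^^ \<nu>) f) y / fact \<nu>) ([:- y, 1:] ^ \<nu>))"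

(* d j is the highest derivative order at the mass point c j, for j = 1, ..., N;
   lam j k is the coefficient of the term with k-th derivatives. *)
context
  fixes \<alpha> \<beta> :: real
    and N :: nat
    and d :: "nat \<Rightarrow> nat"
    and lam :: "nat \<Rightarrow> nat \<Rightarrow> real"
    and c :: "nat \<Rightarrow> real"
begin

definition Iplus :: "(nat \<times> nat) set" where
  "Iplus = {(j, k). 1 \<le> j \<and> j \<le> N \<and> k \<le> d j \<and> lam j k > 0}"

definition sobolev_ip :: "real poly \<Rightarrow> real poly \<Rightarrow> real" where
  "sobolev_ip f g = jacobi_ip \<alpha> \<beta> f g +
     (\<Sum>(j, k)\<in>Iplus. lam j k * poly ((pderiv ^^ k) f) (c j) * poly ((pderiv ^^ k) g) (c j))"

definition sobolev_poly :: "nat \<Rightarrow> real poly" where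
  "sobolev_poly n = monic_orth_poly sobolev_ip n"

definition total_d :: nat where
  "total_d = (\<Sum>j=1..N. (d j + 1))"

definition rho :: "real poly" where
  "rho = (\<Prod>j=1..N. [:- c j, 1:] ^ (d j + 1))"

(* For (j, k) in Iplus the division is exact. *)
definition rho_jk :: "nat \<Rightarrow> nat \<Rightarrow> real poly" where
  "rho_jk j k = rho div [:- c j, 1:] ^ (k + 1)"

(* The families indexed by n below are meaningful for n \<ge> 1 (A2, B2, A3, B3)
   and for n \<ge> 2 (all others). *)

definition A2 :: "nat \<Rightarrow> real poly" where
  "A2 n = rho - (\<Sum>(j, k)\<in>Iplus.
     smult (fact k * lam j k * poly ((pderiv ^^ k) (sobolev_poly n)) (c j) / jacobi_h \<alpha> \<beta> (n - 1))
       (taylor_Q k (c j) (jacobi_poly \<alpha> \<beta> (n - 1)) * rho_jk j k))"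

definition B2 :: "nat \<Rightarrow> real poly" where
  "B2 n = (\<Sum>(j, k)\<in>Iplus.
     smult (fact k * lam j k * poly ((pderiv ^^ k) (sobolev_poly n)) (c j) / jacobi_h \<alpha> \<beta> (n - 1))
       (taylor_Q k (c j) (jacobi_poly \<alpha> \<beta> n) * rho_jk j k))"

definition A3 :: "nat \<Rightarrow> real poly" where
  "A3 n = [:1, 0, -1:] * pderiv (A2 n) + a_hat \<alpha> \<beta> n * A2 n + smult (d_hat \<alpha> \<beta> n) (B2 n)"

definition B3 :: "nat \<Rightarrow> real poly" where
  "B3 n = [:1, 0, -1:] * pderiv (B2 n) + smult (b_hat \<alpha> \<beta> n) (A2 n) + c_hat \<alpha> \<beta> n * B2 n"

definition C2 :: "nat \<Rightarrow> real poly" where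
  "C2 n = - smult (1 / gamma2 \<alpha> \<beta> (n - 1)) (B2 (n - 1))"

definition D2 :: "nat \<Rightarrow> real poly" where
  "D2 n = A2 (n - 1) +
     smult (1 / gamma2 \<alpha> \<beta> (n - 1)) (B2 (n - 1) * [:- gamma1 \<alpha> \<beta> (n - 1), 1:])"

definition C3 :: "nat \<Rightarrow> real poly" where
  "C3 n = - smult (1 / gamma2 \<alpha> \<beta> (n - 1)) (B3 (n - 1))"

definition D3 :: "nat \<Rightarrow> real poly" where
  "D3 n = A3 (n - 1) +
     smult (1 / gamma2 \<alpha> \<beta> (n - 1)) (B3 (n - 1) * [:- gamma1 \<alpha> \<beta> (n - 1), 1:])"

definition Delta :: "nat \<Rightarrow> real poly" where
  "Delta n = A2 n * D2 n - C2 n * B2 n"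

(* For n \<ge> 2 the division is exact. *)
definition delta :: "nat \<Rightarrow> real poly" where
  "delta n = Delta n div rho"

definition q0 :: "nat \<Rightarrow> real poly" where
  "q0 n = [:1, 0, -1:] * Delta n"

definition q1 :: "nat \<Rightarrow> real poly" where
  "q1 n = B3 n * A2 n - A3 n * B2 n"

definition q2 :: "nat \<Rightarrow> real poly" where
  "q2 n = [:1, 0, -1:] * pderiv rho * delta n + B3 n * C2 n - A3 n * D2 n"

definition q3 :: "nat \<Rightarrow> real poly" where
  "q3 n = [:1, 0, -1:] * pderiv rho * delta n + C3 n * B2 n - D3 n * A2 n"

definition q4 :: "nat \<Rightarrow> real poly" where
  "q4 n = C3 n * D2 n - D3 n * C2 n"

definition ode_P2 :: "nat \<Rightarrow> real poly" where
  "ode_P2 n = q1 n * (q0 n)\<^sup>2"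

definition ode_P1 :: "nat \<Rightarrow> real poly" where
  "ode_P1 n = q0 n * (q1 n * q2 n + q1 n * q3 n + pderiv (q0 n) * q1 n - q0 n * pderiv (q1 n))"

definition ode_P0 :: "nat \<Rightarrow> real poly" where
  "ode_P0 n = q1 n * q2 n * q3 n
     + q0 n * (pderiv (q2 n) * q1 n - q2 n * pderiv (q1 n)) - q4 n * (q1 n)\<^sup>2"

end

end

theory Submission imports Defs begin

text \<open>
  Expanding \<open>S n\<close> in the Jacobi basis expresses it through derivatives in \<open>y\<close>, at the mass points, of
  the Christoffel--Darboux kernel, so that \<open>\<rho> S n = A2 P n + B2 P (n - 1)\<close>. By the three-term recurrence
  also \<open>\<rho> S (n - 1) = C2 P n + D2 P (n - 1)\<close>, and the structure relations of the Jacobi polynomials give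
  similar formulas for the derivatives of both left-hand sides. Solving for \<open>P n\<close> and \<open>P (n - 1)\<close>
  (determinant \<open>\<Delta>\<close>) yields a first-order system for \<open>S n, S (n - 1)\<close>, and eliminating \<open>S (n - 1)\<close>
  gives the equation. The Jacobi facts follow from the Pearson equation
  \<open>((1 - x\<^sup>2) w)' = (\<beta> - \<alpha> - (\<alpha> + \<beta> + 2) x) w\<close> by comparing coefficients. The degree of the leading
  coefficient is exact because the top coefficients of \<open>q1\<close> and \<open>\<Delta>\<close> are positive; this rests
  on the extremal property of \<open>P n\<close>.
\<close>

section \<open>The Jacobi functional\<close>

text \<open>With derivatives in the Sobolev product, multiplication by \<open>x\<close> is in
  general not symmetric for it, so no three-term recurrence is available for the \<open>S n\<close>.
  This is why everything passes through the pair \<open>P n\<close>, \<open>P (n - 1)\<close>, where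
  recurrence and derivative formulas exist. Returning to \<open>S n\<close>,
  \<open>S (n - 1)\<close> introduces the determinant, and \<open>rho\<close> can be cancelled from
  it because consecutive Jacobi polynomials have no common factor. For the exact degree, let
  \<open>b n\<close> be the coefficient of \<open>B2 n\<close> at \<open>total_d - 1\<close>, with
  value 0 if this is negative. The top coefficients are then
  \<open>b_hat + (2 n + \<alpha> + \<beta> + 1) b n\<close> for \<open>q1\<close> and
  \<open>1 + b (n - 1) / gamma2\<close> for the determinant, with \<open>gamma2\<close> taken at
  \<open>n - 1\<close>, so both signs reduce to \<open>b\<close> being nonnegative.\<close>

definition jacobi_weight :: "real \<Rightarrow> real \<Rightarrow> real \<Rightarrow> real" where
  "jacobi_weight \<alpha> \<beta> x = indicator {-1..1} x * ((1 - x) powr \<alpha> * (1 + x) powr \<beta>)"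

lemma jacobi_weight_nonneg: "0 \<le> jacobi_weight \<alpha> \<beta> x"
  by (simp add: jacobi_weight_def)

lemma jacobi_weight_measurable [measurable]: "jacobi_weight \<alpha> \<beta> \<in> borel_measurable borel"
  unfolding jacobi_weight_def by measurable

lemma jacobi_measure_eq_density: "jacobi_measure \<alpha> \<beta> = density lborel (\<lambda>x. ennreal (jacobi_weight \<alpha> \<beta> x))"
  by (simp add: jacobi_measure_def jacobi_weight_def)

lemma poly_measurable [measurable]: "poly (p :: real poly) \<in> borel_measurable borel"
  by (intro borel_measurable_continuous_onI continuous_intros)

text \<open>The substitution \<open>t = (1 + x) / 2\<close> turns the weight into a constant
  multiple of the Beta integrand with parameters \<open>\<beta> + 1\<close> and
  \<open>\<alpha> + 1\<close>.\<close>

lemma integrable_jacobi_weight: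
  assumes "\<alpha> > -1" "\<beta> > -1"
  shows "integrable lborel (jacobi_weight \<alpha> \<beta>)"
proof -
  let ?f = "\<lambda>t::real. indicator {0..1} t * (t powr \<beta> * (1 - t) powr \<alpha>)"
  have "integrable lborel ?f"
    using integrable_Beta[of "\<beta> + 1" "\<alpha> + 1"] assms by (simp add: set_integrable_def)
  then have "integrable lborel (\<lambda>x. ?f (1/2 + (1/2) * x))"
    by (rule lborel_integrable_real_affine) simp
  then have "integrable lborel (\<lambda>x. 2 powr \<beta> * 2 powr \<alpha> * ?f (1/2 + (1/2) * x))"
    by (rule integrable_mult_right)
  moreover have "2 powr \<beta> * 2 powr \<alpha> * ?f (1/2 + (1/2) * x) = jacobi_weight \<alpha> \<beta> x" for x :: real
  proof (cases "x \<in> {-1..1}")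
    case True
    have "(1 + x) powr \<beta> = (2 * (1/2 + (1/2) * x)) powr \<beta>"
      "(1 - x) powr \<alpha> = (2 * (1 - (1/2 + (1/2) * x))) powr \<alpha>"
      by (simp_all add: algebra_simps)
    then have "(1 + x) powr \<beta> = 2 powr \<beta> * (1/2 + (1/2) * x) powr \<beta>"
      "(1 - x) powr \<alpha> = 2 powr \<alpha> * (1 - (1/2 + (1/2) * x)) powr \<alpha>"
      using True by (auto simp only: powr_mult)
    with True show ?thesis
      by (simp add: jacobi_weight_def)
  next
    case False
    then have "1/2 + (1/2) * x \<notin> {0..1}" by auto
    with False show ?thesis
      unfolding jacobi_weight_def by (simp only: indicator_simps mult_zero_left mult_zero_right not_False_eq_True)
  qed
  ultimately show ?thesis
    by (simp only:)
qed

lemma integrable_jacobi_weight_poly: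
  assumes "\<alpha> > -1" "\<beta> > -1"
  shows "integrable lborel (\<lambda>x. jacobi_weight \<alpha> \<beta> x * poly p x)"
proof -
  have "bounded (poly p ` {-1..1})"
    by (intro compact_imp_bounded compact_continuous_image continuous_intros) auto
  then obtain B where "\<forall>y \<in> poly p ` {-1..1}. norm y \<le> B"
    unfolding bounded_iff ..
  then have B: "\<bar>poly p x\<bar> \<le> B" if "x \<in> {-1..1}" for x
    using that by simp
  show ?thesis
  proof (rule Bochner_Integration.integrable_bound)
    show "integrable lborel (\<lambda>x. B * jacobi_weight \<alpha> \<beta> x)"
      using integrable_jacobi_weight[OF assms] by simp
    show "AE x in lborel. norm (jacobi_weight \<alpha> \<beta> x * poly p x) \<le> norm (B * jacobi_weight \<alpha> \<beta> x)"
    proof (rule AE_I2)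
      fix x :: real
      show "norm (jacobi_weight \<alpha> \<beta> x * poly p x) \<le> norm (B * jacobi_weight \<alpha> \<beta> x)"
      proof (cases "x \<in> {-1..1}")
        case True
        then have "\<bar>poly p x\<bar> \<le> \<bar>B\<bar>"
          using B[of x] by linarith
        then show ?thesis
          by (simp add: abs_mult mult.commute mult_right_mono)
      qed (simp add: jacobi_weight_def)
    qed
  qed simp
qed

definition jacobi_functional :: "real \<Rightarrow> real \<Rightarrow> real poly \<Rightarrow> real" where
  "jacobi_functional \<alpha> \<beta> p = (\<integral>x. jacobi_weight \<alpha> \<beta> x * poly p x \<partial>lborel)"

lemma integral_jacobi_measure:
  "(\<integral>x. poly p x \<partial>jacobi_measure \<alpha> \<beta>) = jacobi_functional \<alpha> \<beta> p"
  unfolding jacobi_measure_eq_density jacobi_functional_def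
  by (subst integral_density) (auto simp: jacobi_weight_nonneg)

lemma jacobi_ip_eq_functional: "jacobi_ip \<alpha> \<beta> p q = jacobi_functional \<alpha> \<beta> (p * q)"
  by (simp add: jacobi_ip_def flip: integral_jacobi_measure)

text \<open>If the integral vanished, the integrand would be zero almost everywhere. Off the
  finitely many roots of \<open>p\<close> it is positive on the open interval, which is not a null
  set.\<close>

lemma jacobi_functional_pos:
  assumes "\<alpha> > -1" "\<beta> > -1" and "p \<noteq> 0"
  shows "jacobi_functional \<alpha> \<beta> (p * p) > 0"
proof -
  let ?f = "\<lambda>x. jacobi_weight \<alpha> \<beta> x * poly (p * p) x"
  have nonneg: "?f x \<ge> 0" for x
    by (simp add: jacobi_weight_nonneg)
  have "jacobi_functional \<alpha> \<beta> (p * p) \<noteq> 0"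
  proof
    assume "jacobi_functional \<alpha> \<beta> (p * p) = 0"
    then have "AE x in lborel. ?f x = 0"
      unfolding jacobi_functional_def
      using integral_nonneg_eq_0_iff_AE[OF integrable_jacobi_weight_poly[OF assms(1,2)], of "p * p"] nonneg
      by simp
    moreover have "AE x in lborel. x \<notin> {x. poly p x = 0}"
      by (intro AE_not_in finite_imp_null_set_lborel poly_roots_finite assms)
    ultimately have "AE x in lborel. x \<notin> {-1<..<1 :: real}"
      by eventually_elim (auto simp: jacobi_weight_def)
    then have "emeasure lborel {-1<..<1 :: real} = 0"
      by (subst (asm) AE_iff_measurable[where N = "{-1<..<1 :: real}"]) auto
    then show False by simp
  qed
  moreover have "jacobi_functional \<alpha> \<beta> (p * p) \<ge> 0"
    unfolding jacobi_functional_def by (intro integral_nonneg_AE AE_I2 nonneg)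
  ultimately show ?thesis by simp
qed

text \<open>Integrating the derivative of \<^term>\<open>(1 - x) powr (\<alpha> + 1) * (1 + x) powr (\<beta> + 1) * poly p x\<close>.\<close>

lemma jacobi_functional_pearson:
  assumes "\<alpha> > -1" "\<beta> > -1"
  shows "jacobi_functional \<alpha> \<beta> ([:1, 0, -1:] * pderiv p + [:\<beta> - \<alpha>, - (\<alpha> + \<beta> + 2):] * p) = 0"
proof -
  let ?q = "[:1, 0, -1:] * pderiv p + [:\<beta> - \<alpha>, - (\<alpha> + \<beta> + 2):] * p"
  let ?F = "\<lambda>x. (1 - x) powr (\<alpha> + 1) * (1 + x) powr (\<beta> + 1) * poly p x"
  let ?f = "\<lambda>x. (1 - x) powr \<alpha> * (1 + x) powr \<beta> * poly ?q x"
  have "(?f has_integral (?F 1 - ?F (- 1))) {-1..1}"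
  \<comment> \<open>The powers may fail to be differentiable at the endpoints, so only interior
    derivatives are used; at the endpoints \<open>?F\<close> is continuous and vanishes, since both
    exponents are positive.\<close>
  proof (rule fundamental_theorem_of_calculus_interior)
    show "continuous_on {-1..1} ?F"
      using assms by (intro continuous_intros continuous_on_powr') auto
    fix x :: real
    assume x: "x \<in> {-1<..<1}"
    have pw: "(1 - x) powr (\<alpha> + 1) = (1 - x) * (1 - x) powr \<alpha>"
      "(1 + x) powr (\<beta> + 1) = (1 + x) * (1 + x) powr \<beta>"
      using x by (simp_all add: powr_add)
    let ?D = "(- (\<alpha> + 1) * (1 - x) powr \<alpha>) * ((1 + x) powr (\<beta> + 1)) * poly p x
        + (1 - x) powr (\<alpha> + 1) * ((\<beta> + 1) * (1 + x) powr \<beta>) * poly p x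
        + (1 - x) powr (\<alpha> + 1) * (1 + x) powr (\<beta> + 1) * poly (pderiv p) x"
    have "(?F has_real_derivative ?D) (at x)"
      using x by (auto intro!: derivative_eq_intros simp: algebra_simps)
    moreover have "?D = ?f x"
      unfolding pw by (simp add: algebra_simps)
    ultimately have "(?F has_real_derivative ?f x) (at x)"
      by (rule DERIV_cong)
    then show "(?F has_vector_derivative ?f x) (at x)"
      by (simp add: has_real_derivative_iff_has_vector_derivative)
  qed simp
  then have "(?f has_integral 0) {-1..1}"
    using assms by simp
  then have "((\<lambda>x. if x \<in> {-1..1} then ?f x else 0) has_integral 0) UNIV"
    by (simp only: has_integral_restrict_UNIV)
  also have "(\<lambda>x. if x \<in> {-1..1} then ?f x else 0) = (\<lambda>x. jacobi_weight \<alpha> \<beta> x * poly ?q x)"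
    by (auto simp: jacobi_weight_def)
  finally have "((\<lambda>x. jacobi_weight \<alpha> \<beta> x * poly ?q x) has_integral 0) UNIV" .
  moreover have "((\<lambda>x. jacobi_weight \<alpha> \<beta> x * poly ?q x) has_integral
      jacobi_functional \<alpha> \<beta> ?q) UNIV"
    unfolding jacobi_functional_def
    by (intro has_integral_integral_lborel integrable_jacobi_weight_poly assms)
  ultimately show ?thesis
    using has_integral_unique by blast
qed

lemma jacobi_functional_add:
  assumes "\<alpha> > -1" "\<beta> > -1"
  shows "jacobi_functional \<alpha> \<beta> (p + q) = jacobi_functional \<alpha> \<beta> p + jacobi_functional \<alpha> \<beta> q"
  using integrable_jacobi_weight_poly[OF assms]
  by (simp add: jacobi_functional_def distrib_left)

lemma jacobi_functional_smult:
  "jacobi_functional \<alpha> \<beta> (smult a p) = a * jacobi_functional \<alpha> \<beta> p"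
  by (simp add: jacobi_functional_def mult.left_commute)

section \<open>Monic orthogonal polynomials\<close>

lemma degree_lessI_coeff:
  assumes "\<forall>i\<ge>n. coeff p i = 0" "p \<noteq> 0"
  shows "degree p < n"
  using assms by (metis leading_coeff_0_iff not_le)

text \<open>The first alternative covers a zero remainder, whose degree 0 is not below
  \<open>n\<close> when \<open>n = 0\<close>.\<close>

lemma degree_diff_smult_monic:
  fixes p q :: "'a::comm_ring_1 poly"
  assumes "degree p = n" "coeff p n = 1" "degree q \<le> n"
  shows "q = smult (coeff q n) p \<or> degree (q - smult (coeff q n) p) < n"
proof -
  have "coeff (q - smult (coeff q n) p) i = 0" if "i \<ge> n" for i
    using that assms coeff_eq_0[of p i] coeff_eq_0[of q i] by (cases "i = n") auto
  then show ?thesis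
    using degree_lessI_coeff[of n "q - smult (coeff q n) p"] by fastforce
qed

text \<open>Instantiated twice: by the Jacobi product, which is a functional of
  \<open>p * q\<close>, and by the Sobolev product, which in general is not.\<close>

locale poly_inner_product =
  fixes ip :: "real poly \<Rightarrow> real poly \<Rightarrow> real"
  assumes add_left: "ip (p + q) r = ip p r + ip q r"
    and smult_left: "ip (smult a p) r = a * ip p r"
    and commute: "ip p q = ip q p"
    and pos: "p \<noteq> 0 \<Longrightarrow> ip p p > 0"
begin

lemma add_right: "ip r (p + q) = ip r p + ip r q"
  by (metis add_left commute)

lemma smult_right: "ip r (smult a p) = a * ip r p"
  by (metis smult_left commute)

lemma zero_left [simp]: "ip 0 p = 0"
  using smult_left[of 0 0 p] by simp

lemma zero_right [simp]: "ip p 0 = 0"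
  using smult_right[of p 0 0] by simp

lemma diff_left: "ip (p - q) r = ip p r - ip q r"
  using add_left[of "p - q" q r] by simp

lemma diff_right: "ip r (p - q) = ip r p - ip r q"
  using add_right[of r "p - q" q] by simp

lemma sum_right: "ip r (\<Sum>i\<in>A. f i) = (\<Sum>i\<in>A. ip r (f i))"
  by (induction A rule: infinite_finite_induct) (auto simp: add_right)

lemma eq_0_iff: "ip p p = 0 \<longleftrightarrow> p = 0"
  using pos[of p] by fastforce

lemma nonneg: "ip p p \<ge> 0"
  using pos[of p] by (cases "p = 0") auto

text \<open>Subtracting the right multiple of \<open>P m\<close> lowers the degree. The basis is
  left general because it is taken to be the monomials, the family \<open>orth\<close>, and the
  partial family inside the Gram-Schmidt construction.\<close>

lemma eq_0_of_monic_basis: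
  assumes "\<And>i. i < n \<Longrightarrow> degree (P i) = i \<and> coeff (P i) i = 1 \<and> ip (P i) r = 0"
    and "degree q < n"
  shows "ip q r = 0"
  using assms
proof (induction n arbitrary: q)
  case (Suc m)
  have "q = smult (coeff q m) (P m) \<or> degree (q - smult (coeff q m) (P m)) < m"
    by (rule degree_diff_smult_monic) (use Suc.prems(1)[of m] Suc.prems(2) in auto)
  moreover have "ip (q - smult (coeff q m) (P m)) r = 0"
    if "degree (q - smult (coeff q m) (P m)) < m"
    using that Suc.prems(1) by (intro Suc.IH) auto
  moreover have "ip q r = ip (q - smult (coeff q m) (P m)) r"
    using Suc.prems(1)[of m] by (simp add: diff_left smult_left)
  ultimately show ?case
    by (metis diff_self zero_left)
qed simp

lemma eq_0_of_monom:
  assumes "\<forall>i<n. ip (monom 1 i) r = 0" "degree q < n"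
  shows "ip q r = 0"
  using assms by (intro eq_0_of_monic_basis[where P = "monom 1"]) (auto simp: degree_monom_eq)

text \<open>Gram-Schmidt: \<open>s\<close> is the projection of \<open>monom 1 n\<close> onto the
  lower orthogonal polynomials, which the strong induction supplies.\<close>

lemma ex_monic_orth:
  "\<exists>p. degree p = n \<and> coeff p n = 1 \<and> (\<forall>i<n. ip (monom 1 i) p = 0)"
proof (induction n rule: less_induct)
  case (less n)
  then obtain P where
    P: "\<And>i. i < n \<Longrightarrow> degree (P i) = i \<and> coeff (P i) i = 1 \<and> (\<forall>j<i. ip (monom 1 j) (P i) = 0)"
    by metis
  have ortho: "ip (P i) (P j) = 0" if "i < n" "j < n" "i \<noteq> j" for i j
    using that P[of i] P[of j] eq_0_of_monom[of i "P i" "P j"] eq_0_of_monom[of j "P j" "P i"]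
    by (metis commute linorder_neqE_nat)
  have nz: "ip (P i) (P i) \<noteq> 0" if "i < n" for i
    using P[OF that] eq_0_iff by force
  define s where "s = (\<Sum>i<n. smult (ip (P i) (monom 1 n) / ip (P i) (P i)) (P i))"
  let ?p = "monom 1 n - s"
  have "coeff s i = 0" if "i \<ge> n" for i
    using that P by (auto simp: s_def coeff_sum coeff_eq_0 intro!: sum.neutral)
  then have c: "coeff ?p i = (if i = n then 1 else 0)" if "i \<ge> n" for i
    using that by auto
  then have deg: "degree ?p = n"
    by (intro antisym degree_le le_degree) (simp_all del: coeff_diff)
  have "ip (P j) ?p = 0" if "j < n" for j
  proof -
    have "ip (P j) s = (\<Sum>i<n. if i = j then ip (P j) (monom 1 n) else 0)"
      unfolding s_def sum_right by (intro sum.cong) (use that ortho nz in \<open>auto simp: smult_right\<close>)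
    then show ?thesis
      using that by (simp add: diff_right)
  qed
  then have "ip (monom 1 i) ?p = 0" if "i < n" for i
    using that P by (intro eq_0_of_monic_basis[of n P]) (auto simp: degree_monom_eq)
  with deg c show ?case
    by (intro exI[of _ ?p]) (simp del: coeff_diff)
qed

definition orth :: "nat \<Rightarrow> real poly" where
  "orth = monic_orth_poly ip"

lemma orth_unique:
  assumes "degree p = n" "coeff p n = 1" "\<forall>i<n. ip (monom 1 i) p = 0"
    and "degree q = n" "coeff q n = 1" "\<forall>i<n. ip (monom 1 i) q = 0"
  shows "p = q"
proof (rule ccontr)
  assume "p \<noteq> q"
  then have "degree (p - q) < n"
    using degree_diff_smult_monic[of q n p] assms by auto
  moreover have "\<forall>i<n. ip (monom 1 i) (p - q) = 0"
    using assms by (simp add: diff_right)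
  ultimately have "ip (p - q) (p - q) = 0"
    by (intro eq_0_of_monom)
  with \<open>p \<noteq> q\<close> show False
    by (simp add: eq_0_iff)
qed

lemma orth_props:
  "degree (orth n) = n \<and> coeff (orth n) n = 1 \<and> (\<forall>i<n. ip (monom 1 i) (orth n) = 0)"
proof -
  let ?R = "\<lambda>p. degree p = n \<and> coeff p n = 1 \<and> (\<forall>i<n. ip (monom 1 i) p = 0)"
  have "orth n = (THE p. ?R p)"
    unfolding orth_def monic_orth_poly_def by (rule arg_cong[where f = The]) auto
  moreover have "\<exists>!p. ?R p"
    using ex_monic_orth[of n] orth_unique by blast
  ultimately show ?thesis
    using theI'[of ?R] by simp
qed

lemma degree_orth [simp]: "degree (orth n) = n"
  using orth_props by blast

lemma coeff_orth_self [simp]: "coeff (orth n) n = 1"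
  using orth_props[of n] by simp

lemma orth_nonzero [simp]: "orth n \<noteq> 0"
  using coeff_orth_self[of n] by force

lemma orth_0 [simp]: "orth 0 = 1"
  by (metis coeff_orth_self coeff_pCons_0 degree_eq_zeroE degree_orth one_pCons)

lemma ip_orth_lower: "degree q < n \<Longrightarrow> ip q (orth n) = 0"
  using eq_0_of_monom orth_props by blast

lemma ip_orth_lower': "degree q < n \<Longrightarrow> ip (orth n) q = 0"
  using ip_orth_lower commute by metis

lemma ip_orth_orth: "i \<noteq> j \<Longrightarrow> ip (orth i) (orth j) = 0"
  by (cases "i < j") (auto intro: ip_orth_lower ip_orth_lower')

definition sqnorm :: "nat \<Rightarrow> real" where
  "sqnorm n = ip (orth n) (orth n)"

lemma sqnorm_pos [simp]: "sqnorm n > 0"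
  by (simp add: sqnorm_def pos)

lemma sqnorm_nonzero [simp]: "sqnorm n \<noteq> 0"
  using sqnorm_pos[of n] by linarith

lemma ip_orth_le:
  assumes "degree q \<le> n"
  shows "ip q (orth n) = coeff q n * sqnorm n"
proof -
  have "q = smult (coeff q n) (orth n) \<or> degree (q - smult (coeff q n) (orth n)) < n"
    by (rule degree_diff_smult_monic) (use assms in auto)
  then have "ip (q - smult (coeff q n) (orth n)) (orth n) = 0"
    using ip_orth_lower by (metis diff_self zero_left)
  then show ?thesis
    by (simp add: diff_left smult_left sqnorm_def)
qed

lemma eq_0_of_orth:
  assumes "\<And>i. i \<le> n \<Longrightarrow> ip (orth i) q = 0" "degree q \<le> n"
  shows "q = 0"
proof -
  have "ip q q = 0"
    by (rule eq_0_of_monic_basis[of "Suc n" orth]) (use assms in auto)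
  then show ?thesis by (simp add: eq_0_iff)
qed

text \<open>Pythagoras: \<open>p - orth n\<close> has no coefficient at \<open>n\<close>, so it is
  orthogonal to \<open>orth n\<close>.\<close>

lemma sqnorm_le:
  assumes "degree p = n" "coeff p n = 1"
  shows "sqnorm n \<le> ip p p"
proof -
  let ?r = "p - orth n"
  have "ip ?r (orth n) = 0"
    using assms ip_orth_le[of p n] by (simp add: diff_left flip: sqnorm_def)
  then have "ip p p = sqnorm n + ip ?r ?r"
    by (simp add: diff_left diff_right sqnorm_def commute)
  then show ?thesis
    using nonneg[of ?r] by simp
qed

end

section \<open>Taylor coefficients\<close>

text \<open>The division by \<open>fact k\<close> turns the Leibniz rule for a linear factor into a
  plain shift from \<open>k\<close> to \<open>k - 1\<close>.\<close>

definition taylor_coeff :: "nat \<Rightarrow> real \<Rightarrow> real poly \<Rightarrow> real" where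
  "taylor_coeff k a p = poly ((pderiv ^^ k) p) a / fact k"

lemma higher_pderiv_linear_mult:
  fixes p :: "real poly"
  shows "(pderiv ^^ Suc k) ([:b, 1:] * p) = [:b, 1:] * (pderiv ^^ Suc k) p + of_nat (Suc k) * (pderiv ^^ k) p"
proof -
  have D: "pderiv ([:b, 1:] * q) = [:b, 1:] * pderiv q + q" for q :: "real poly"
    unfolding pderiv_mult by (simp add: pderiv_pCons)
  show ?thesis
  proof (induction k)
    case 0
    then show ?case
      using D[of p] by (simp del: mult_pCons_left)
  next
    case (Suc k)
    have "(pderiv ^^ Suc (Suc k)) ([:b, 1:] * p) = pderiv ((pderiv ^^ Suc k) ([:b, 1:] * p))"
      by simp
    also have "\<dots> = [:b, 1:] * (pderiv ^^ Suc (Suc k)) p + (pderiv ^^ Suc k) p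
        + of_nat (Suc k) * (pderiv ^^ Suc k) p"
      unfolding Suc pderiv_add D
      by (simp add: pderiv_mult pderiv_smult of_nat_poly pderiv_pCons del: of_nat_Suc)
    finally show ?case by (simp add: algebra_simps)
  qed
qed

lemma higher_pderiv_diff: "(pderiv ^^ k) (p - q) = (pderiv ^^ k) p - (pderiv ^^ k) (q :: real poly)"
  by (induction k) (auto simp: pderiv_diff)

lemma taylor_coeff_diff: "taylor_coeff k a (p - q) = taylor_coeff k a p - taylor_coeff k a q"
  by (simp add: taylor_coeff_def higher_pderiv_diff diff_divide_distrib)

lemma taylor_coeff_smult: "taylor_coeff k a (smult b p) = b * taylor_coeff k a p"
  by (simp add: taylor_coeff_def higher_pderiv_smult)

lemma taylor_coeff_linear_mult:
  "taylor_coeff k a ([:b, 1:] * p) = (a + b) * taylor_coeff k a p + (if k = 0 then 0 else taylor_coeff (k - 1) a p)"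
proof (cases k)
  case 0
  then show ?thesis
    by (simp add: taylor_coeff_def algebra_simps)
next
  case (Suc j)
  show ?thesis
    unfolding Suc taylor_coeff_def higher_pderiv_linear_mult
    by (simp add: field_simps del: of_nat_Suc funpow.simps)
qed

lemma taylor_Q_eq: "taylor_Q k a p = (\<Sum>\<nu>\<le>k. smult (taylor_coeff \<nu> a p) ([:- a, 1:] ^ \<nu>))"
  by (simp add: taylor_Q_def taylor_coeff_def)

section \<open>The three-term recurrence and the Christoffel--Darboux formula\<close>

text \<open>Since the product depends on \<open>p * q\<close> alone, a factor \<open>x\<close> can
  be moved from one argument to the other; the three-term recurrence rests on this.\<close>

locale poly_functional =
  fixes L :: "real poly \<Rightarrow> real"
  assumes L_add: "L (p + q) = L p + L q"
    and L_smult: "L (smult a p) = a * L p"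
    and L_pos: "p \<noteq> 0 \<Longrightarrow> L (p * p) > 0"
begin

sublocale poly_inner_product "\<lambda>p q. L (p * q)"
proof unfold_locales
  show "L (p * q) = L (q * p)" for p q
    by (simp add: mult.commute)
qed (simp_all add: L_add L_smult L_pos distrib_right)

definition rec_a :: "nat \<Rightarrow> real" where
  "rec_a n = L (pCons 0 (orth n) * orth n) / sqnorm n"

definition rec_b :: "nat \<Rightarrow> real" where
  "rec_b n = sqnorm n / sqnorm (n - 1)"

lemma rec_b_pos: "rec_b n > 0"
  by (simp add: rec_b_def)

text \<open>The remainder \<open>?T\<close> has degree at most \<open>n + 1\<close> and is
  orthogonal to every \<open>orth i\<close> in that range: for \<open>i < n\<close>, moving the
  factor \<open>x\<close> onto \<open>orth i\<close> leaves a degree below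
  \<open>n + 1\<close>.\<close>

lemma orth_Suc_Suc:
  "orth (Suc (Suc n)) = [:- rec_a (Suc n), 1:] * orth (Suc n) - smult (rec_b (Suc n)) (orth n)"
proof -
  let ?T = "pCons 0 (orth (Suc n)) - orth (Suc (Suc n)) - smult (rec_a (Suc n)) (orth (Suc n))
     - smult (rec_b (Suc n)) (orth n)"
  have "coeff ?T i = 0" if "i \<ge> Suc (Suc n)" for i
    using that by (cases "i = Suc (Suc n)") (auto simp: coeff_eq_0 coeff_pCons split: nat.split)
  then have deg: "degree ?T \<le> Suc n"
    by (intro degree_le) auto
  have "?T = 0"
  proof (rule eq_0_of_orth[OF _ deg])
    fix i assume i: "i \<le> Suc n"
    have shift: "L (orth i * pCons 0 q) = L (pCons 0 (orth i) * q)" for q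
      by simp
    consider "i = Suc n" | "i = n" | "i < n" using i by linarith
    then show "L (orth i * ?T) = 0"
    proof cases
      case 1
      have "L (orth (Suc n) * pCons 0 (orth (Suc n))) = rec_a (Suc n) * sqnorm (Suc n)"
        by (simp add: rec_a_def)
      with 1 show ?thesis
        by (simp only: diff_right smult_right flip: sqnorm_def) (simp add: ip_orth_orth)
    next
      case 2
      \<comment> \<open>Moved to the other side, \<open>x * orth n\<close> is monic of degree
        \<open>n + 1\<close>; this yields the quotient of norms in \<open>rec_b\<close>.\<close>
      have "L (orth n * pCons 0 (orth (Suc n))) = sqnorm (Suc n)"
        unfolding 2[symmetric] shift by (subst ip_orth_le) (auto simp: 2)
      with 2 show ?thesis
        by (simp only: diff_right smult_right ip_orth_orth rec_b_def flip: sqnorm_def)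
          (simp add: ip_orth_orth)
    next
      case 3
      have "L (orth i * pCons 0 (orth (Suc n))) = 0"
        unfolding shift by (rule ip_orth_lower) (use 3 in \<open>auto intro: le_less_trans[OF degree_pCons_le]\<close>)
      with 3 show ?thesis
        by (simp only: diff_right smult_right) (simp add: ip_orth_orth)
    qed
  qed
  then show ?thesis
    by (simp add: algebra_simps)
qed

lemma orth_Suc_0: "orth (Suc 0) = [:- rec_a 0, 1:]"
proof -
  let ?T = "pCons 0 (orth 0) - orth (Suc 0) - smult (rec_a 0) (orth 0)"
  have "coeff ?T i = 0" if "i \<ge> Suc 0" for i
    using that by (cases "i = Suc 0") (auto simp: coeff_eq_0 coeff_pCons split: nat.split)
  then have deg: "degree ?T \<le> 0"
    by (intro degree_le) auto
  have "?T = 0"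
  proof (rule eq_0_of_orth[OF _ deg])
    fix i :: nat assume "i \<le> 0"
    then have "i = 0" by simp
    moreover have "L (orth 0 * orth (Suc 0)) = 0"
      by (rule ip_orth_orth) simp
    ultimately show "L (orth i * ?T) = 0"
      by (simp only: diff_right smult_right flip: sqnorm_def) (simp add: rec_a_def mult.commute)
  qed
  then have "orth (Suc 0) = pCons 0 1 - [:rec_a 0:]"
    by (simp add: algebra_simps)
  then show ?thesis
    by (simp add: one_pCons)
qed

text \<open>The Taylor coefficient of order \<open>k\<close> at \<open>y = a\<close> of the kernel,
  the sum over \<open>i < n\<close> of \<open>orth i (x) * orth i (y) / sqnorm i\<close>, as a
  polynomial in \<open>x\<close>.\<close>

definition kernel_coeff :: "nat \<Rightarrow> real \<Rightarrow> nat \<Rightarrow> real poly" where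
  "kernel_coeff k a n = (\<Sum>i<n. smult (taylor_coeff k a (orth i) / sqnorm i) (orth i))"

lemma kernel_coeff_Suc:
  "kernel_coeff k a (Suc n) = kernel_coeff k a n + smult (taylor_coeff k a (orth n) / sqnorm n) (orth n)"
  by (simp add: kernel_coeff_def)

text \<open>The Taylor coefficients at \<open>y = a\<close> of the classical formula for \<open>(x - y) K(x, y)\<close>,
  where \<open>x - y\<close> is split as \<open>(x - a) - (y - a)\<close>.\<close>

lemma christoffel_darboux_step:
  "smult (sqnorm n) ([:- a, 1:] * kernel_coeff k a (Suc n) - (if k = 0 then 0 else kernel_coeff (k - 1) a (Suc n)))
   = smult (taylor_coeff k a (orth n)) (orth (Suc n)) - smult (taylor_coeff k a (orth (Suc n))) (orth n)"
proof (induction n)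
  case 0
  define t t' where "t = taylor_coeff k a 1" and "t' = (if k = 0 then 0 else taylor_coeff (k - 1) a 1)"
  have "taylor_coeff k a (orth (Suc 0)) = (a - rec_a 0) * t + t'"
    using taylor_coeff_linear_mult[of k a "- rec_a 0" 1] by (simp add: orth_Suc_0 t_def t'_def)
  then show ?case
    by (auto simp: kernel_coeff_def orth_Suc_0 t_def t'_def algebra_simps)
next
  case (Suc n)
  define t t' where "t = (\<lambda>i. taylor_coeff k a (orth i))"
    and "t' = (if k = 0 then 0 else taylor_coeff (k - 1) a (orth (Suc n)))"
  define K K' where "K = kernel_coeff k a (Suc n)"
    and "K' = (if k = 0 then 0 else kernel_coeff (k - 1) a (Suc n))"
  define b where "b = rec_b (Suc n)"
  have b: "b * sqnorm n = sqnorm (Suc n)"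
    by (simp add: b_def rec_b_def)
  have K: "kernel_coeff k a (Suc (Suc n)) = K + smult (t (Suc n) / sqnorm (Suc n)) (orth (Suc n))"
    "(if k = 0 then 0 else kernel_coeff (k - 1) a (Suc (Suc n))) = K' + smult (t' / sqnorm (Suc n)) (orth (Suc n))"
    unfolding kernel_coeff_Suc[of _ _ "Suc n"] K_def K'_def t_def t'_def by simp_all
  have t2: "t (Suc (Suc n)) = (a - rec_a (Suc n)) * t (Suc n) + t' - b * t n"
    unfolding t_def orth_Suc_Suc taylor_coeff_diff taylor_coeff_smult taylor_coeff_linear_mult
    by (simp add: b_def t'_def)
  have "sqnorm (Suc n) * ((x - a) * (poly K x + t (Suc n) / sqnorm (Suc n) * poly (orth (Suc n)) x)
      - (poly K' x + t' / sqnorm (Suc n) * poly (orth (Suc n)) x))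
    = t (Suc n) * poly (orth (Suc (Suc n))) x - t (Suc (Suc n)) * poly (orth (Suc n)) x" for x
  proof -
    have IH: "sqnorm n * ((x - a) * poly K x - poly K' x)
       = t n * poly (orth (Suc n)) x - t (Suc n) * poly (orth n) x"
      using arg_cong[OF Suc.IH, of "\<lambda>p. poly p x"] unfolding K_def[symmetric] K'_def[symmetric]
      by (simp add: t_def algebra_simps)
    have p2: "poly (orth (Suc (Suc n))) x = (x - rec_a (Suc n)) * poly (orth (Suc n)) x - b * poly (orth n) x"
      unfolding orth_Suc_Suc by (simp add: b_def algebra_simps)
    have "sqnorm (Suc n) * ((x - a) * (poly K x + t (Suc n) / sqnorm (Suc n) * poly (orth (Suc n)) x)
      - (poly K' x + t' / sqnorm (Suc n) * poly (orth (Suc n)) x))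
      = sqnorm (Suc n) * ((x - a) * poly K x - poly K' x)
        + (x - a) * t (Suc n) * poly (orth (Suc n)) x - t' * poly (orth (Suc n)) x"
      by (simp add: field_simps)
    \<comment> \<open>The induction hypothesis enters multiplied by \<open>b\<close>, because
      \<open>b * sqnorm n = sqnorm (Suc n)\<close>; its lower terms then recombine through the
      recurrences for \<open>t\<close> and for the polynomials.\<close>
    also have "sqnorm (Suc n) * ((x - a) * poly K x - poly K' x)
      = b * (t n * poly (orth (Suc n)) x - t (Suc n) * poly (orth n) x)"
      unfolding IH[symmetric] b[symmetric] by simp
    also have "\<dots> + (x - a) * t (Suc n) * poly (orth (Suc n)) x - t' * poly (orth (Suc n)) x
      = t (Suc n) * poly (orth (Suc (Suc n))) x - t (Suc (Suc n)) * poly (orth (Suc n)) x"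
      unfolding t2 p2 by (simp add: algebra_simps)
    finally show ?thesis .
  qed
  moreover have "poly [:- a, 1:] x = x - a" for x
    by simp
  ultimately have "poly (smult (sqnorm (Suc n)) ([:- a, 1:] * (K + smult (t (Suc n) / sqnorm (Suc n)) (orth (Suc n)))
       - (K' + smult (t' / sqnorm (Suc n)) (orth (Suc n)))))
     = poly (smult (t (Suc n)) (orth (Suc (Suc n))) - smult (t (Suc (Suc n))) (orth (Suc n)))"
    by (intro ext) (simp only: poly_smult poly_diff poly_add poly_mult)
  then show ?case
    unfolding K by (simp add: t_def poly_eq_poly_eq_iff)
qed

text \<open>Multiplying the step identity for \<open>k + 1\<close> by
  \<open>[:- a, 1:] ^ (k + 1)\<close> produces the next Taylor term of each polynomial, and the
  kernel subtracted there is the one of the induction hypothesis. The terms add up to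
  \<open>taylor_Q\<close>; hence the Taylor polynomials in \<open>A2\<close> and \<open>B2\<close>
  and the exponent \<open>k + 1\<close> in \<open>rho_jk\<close>.\<close>

lemma christoffel_darboux_taylor:
  "smult (sqnorm n) ([:- a, 1:] ^ Suc k * kernel_coeff k a (Suc n)) =
    taylor_Q k a (orth n) * orth (Suc n) - taylor_Q k a (orth (Suc n)) * orth n"
proof (induction k)
  case 0
  then show ?case
    using christoffel_darboux_step[of n a 0] by (simp add: taylor_Q_eq)
next
  case (Suc k)
  define X where "X = [:- a, 1:]"
  define Y where "Y = X ^ Suc k"
  have split: "smult h (X * Y * K) = Y * smult h (X * K - K') + smult h (Y * K')" for h K K'
    by (simp add: algebra_simps smult_diff_right)
  have "smult (sqnorm n) (X * Y * kernel_coeff (Suc k) a (Suc n))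
    = Y * smult (sqnorm n) (X * kernel_coeff (Suc k) a (Suc n) - kernel_coeff k a (Suc n))
      + smult (sqnorm n) (Y * kernel_coeff k a (Suc n))"
    by (rule split)
  also have "smult (sqnorm n) (X * kernel_coeff (Suc k) a (Suc n) - kernel_coeff k a (Suc n))
    = smult (taylor_coeff (Suc k) a (orth n)) (orth (Suc n))
        - smult (taylor_coeff (Suc k) a (orth (Suc n))) (orth n)"
    using christoffel_darboux_step[of n a "Suc k"] unfolding X_def by simp
  also have "smult (sqnorm n) (Y * kernel_coeff k a (Suc n))
    = taylor_Q k a (orth n) * orth (Suc n) - taylor_Q k a (orth (Suc n)) * orth n"
    using Suc unfolding Y_def X_def .
  finally have "smult (sqnorm n) (X * Y * kernel_coeff (Suc k) a (Suc n)) =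
      Y * (smult (taylor_coeff (Suc k) a (orth n)) (orth (Suc n))
        - smult (taylor_coeff (Suc k) a (orth (Suc n))) (orth n))
      + (taylor_Q k a (orth n) * orth (Suc n) - taylor_Q k a (orth (Suc n)) * orth n)" .
  moreover have "taylor_Q (Suc k) a p = taylor_Q k a p + smult (taylor_coeff (Suc k) a p) Y" for p
    by (simp add: taylor_Q_eq Y_def X_def del: power_Suc)
  moreover have "X ^ Suc (Suc k) = X * Y"
    by (simp add: Y_def)
  ultimately show ?case
    unfolding X_def[symmetric] by (simp add: algebra_simps del: power_Suc)
qed

end

section \<open>Structure relations of the Jacobi polynomials\<close>

text \<open>Shifting by \<open>pCons 0\<close> instead of writing the index \<open>k - 2\<close>
  keeps \<open>k < 2\<close> within the same formula.\<close>

lemma coeff_one_minus_square_mult: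
  fixes p :: "real poly"
  shows "coeff ([:1, 0, -1:] * p) k = coeff p k - coeff (pCons 0 (pCons 0 p)) k"
  by (auto simp: coeff_pCons split: nat.split)

lemma degree_pderiv_mult_linear_le:
  fixes p :: "real poly"
  assumes "degree p \<le> n"
  shows "degree ([:a, b:] * p + [:1, 0, -1:] * pderiv p) \<le> Suc n"
    and "coeff ([:a, b:] * p + [:1, 0, -1:] * pderiv p) (Suc n) = (b - real n) * coeff p n"
proof -
  have p: "coeff p i = 0" if "i > n" for i
    using assms that by (simp add: coeff_eq_0)
  show "degree ([:a, b:] * p + [:1, 0, -1:] * pderiv p) \<le> Suc n"
  proof (rule degree_le, intro allI impI)
    fix i assume "Suc n < i"
    then show "coeff ([:a, b:] * p + [:1, 0, -1:] * pderiv p) i = 0"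
      unfolding coeff_add coeff_one_minus_square_mult
      using p[of i] p[of "i - 1"] p[of "Suc i"]
      by (auto simp: coeff_pderiv coeff_pCons split: nat.split)
  qed
  show "coeff ([:a, b:] * p + [:1, 0, -1:] * pderiv p) (Suc n) = (b - real n) * coeff p n"
    unfolding coeff_add coeff_one_minus_square_mult
    using p[of "Suc n"] p[of "Suc (Suc n)"]
    by (auto simp: coeff_pderiv coeff_pCons algebra_simps split: nat.split)
qed

text \<open>The induction step for the closed form of \<open>rec_b\<close>: \<open>t\<close> stands
  for \<open>2 n + \<alpha> + \<beta>\<close>, so \<open>n + 1\<close> becomes \<open>t + 2\<close>,
  and the squared fraction is \<open>gamma1\<close>.\<close>

lemma gamma_identity:
  fixes t s r :: real
  assumes "t \<noteq> 0" "t + 1 \<noteq> 0" "t + 2 \<noteq> 0"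
  shows "((t + 2)\<^sup>2 - s\<^sup>2) * ((t + 2)\<^sup>2 - r\<^sup>2) / (4 * (t + 2)\<^sup>2 * (t + 1))
    = (t\<^sup>2 - s\<^sup>2) * (t\<^sup>2 - r\<^sup>2) / (4 * t\<^sup>2 * (t + 1)) + 1 - (r * s / (t * (t + 2)))\<^sup>2"
  using assms by (simp add: divide_simps) algebra

locale pearson_functional = poly_functional L for L +
  fixes \<alpha> \<beta> :: real
  assumes params: "\<alpha> > -1" "\<beta> > -1"
    and pearson: "L ([:1, 0, -1:] * pderiv p + [:\<beta> - \<alpha>, - (\<alpha> + \<beta> + 2):] * p) = 0"
begin

text \<open>The Pearson equation for the product \<open>p * q\<close>.\<close>

lemma integration_by_parts:
  "L (p * ([:1, 0, -1:] * pderiv q))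
    = - L (([:\<beta> - \<alpha>, - (\<alpha> + \<beta> + 2):] * p + [:1, 0, -1:] * pderiv p) * q)"
proof -
  have "L (p * ([:1, 0, -1:] * pderiv q)) + L (([:\<beta> - \<alpha>, - (\<alpha> + \<beta> + 2):] * p + [:1, 0, -1:] * pderiv p) * q)
    = L ([:1, 0, -1:] * pderiv (p * q) + [:\<beta> - \<alpha>, - (\<alpha> + \<beta> + 2):] * (p * q))"
    unfolding L_add[symmetric] pderiv_mult
    by (rule arg_cong[where f = L]) algebra
  then show ?thesis
    using pearson[of "p * q"] by simp
qed

abbreviation "s \<equiv> \<alpha> + \<beta>"
abbreviation "r \<equiv> \<beta> - \<alpha>"

lemma L_linear_orth: "L ([:a, b:] * orth n * orth n) = (a + b * rec_a n) * sqnorm n"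
proof -
  have L_xx: "L (pCons 0 (orth n) * orth n) = rec_a n * sqnorm n"
    by (simp add: rec_a_def del: mult_pCons_left)
  have "[:a, b:] * orth n * orth n = smult a (orth n * orth n) + smult b (pCons 0 (orth n) * orth n)"
    by (simp add: distrib_right)
  also have "L \<dots> = a * sqnorm n + b * (rec_a n * sqnorm n)"
    using L_xx by (simp only: L_add L_smult sqnorm_def)
  finally show ?thesis
    by (simp add: algebra_simps)
qed

text \<open>For \<open>i = n\<close>, integration by parts expresses the value through its own
  negative, hence the half. For \<open>Suc i = n\<close> only the leading coefficient
  \<open>- (s + 2) - i\<close> counts, and below that the degree \<open>i + 1\<close> is less than
  \<open>n\<close>.\<close>

lemma L_linear_sq_orth:
  assumes "i \<le> n"
  shows "L (([:r, - (s + 2):] * orth i + [:1, 0, -1:] * pderiv (orth i)) * orth n)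
    = (if i = n then (r - (s + 2) * rec_a n) / 2 * sqnorm n
       else if Suc i = n then - (real n + 1 + s) * sqnorm n else 0)"
proof -
  define W where "W = [:r, - (s + 2):] * orth i + [:1, 0, -1:] * pderiv (orth i)"
  have deg: "degree W \<le> Suc i" and co: "coeff W (Suc i) = - (s + 2) - real i"
    unfolding W_def using degree_pderiv_mult_linear_le[of "orth i" i r "- (s + 2)"] by simp_all
  consider "i = n" | "Suc i = n" | "Suc i < n" using assms by linarith
  then show ?thesis
  proof cases
    case 1
    have "L (W * orth n) = L ([:r, - (s + 2):] * orth n * orth n) + L (orth n * ([:1, 0, -1:] * pderiv (orth n)))"
      unfolding W_def 1 distrib_right L_add by (simp add: mult.commute)
    also have "\<dots> = (r - (s + 2) * rec_a n) * sqnorm n - L (W * orth n)"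
      unfolding L_linear_orth integration_by_parts W_def 1 by (simp add: algebra_simps)
    finally show ?thesis
      unfolding W_def[symmetric] using 1 by simp
  next
    case 2
    have "L (W * orth n) = coeff W n * sqnorm n"
      by (rule ip_orth_le) (use deg 2 in simp)
    then show ?thesis
      unfolding W_def[symmetric] using 2 co by auto
  next
    case 3
    then show ?thesis
      unfolding W_def[symmetric] using ip_orth_lower[of W n] deg by simp
  qed
qed

text \<open>Integration by parts moves the derivative onto \<open>orth i\<close> and raises its
  degree by at most one, so no \<open>orth i\<close> with \<open>i < m\<close> enters the
  expansion.\<close>

lemma structure_relation_three_terms:
  "[:1, 0, -1:] * pderiv (orth (Suc m)) =
     smult (- real (Suc m)) (orth (Suc (Suc m)))
     + smult (- (r - (s + 2) * rec_a (Suc m)) / 2) (orth (Suc m))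
     + smult ((real (Suc m) + 1 + s) * rec_b (Suc m)) (orth m)"
  (is "?D = smult ?A _ + smult ?B _ + smult ?C _")
proof -
  let ?T = "?D - (smult ?A (orth (Suc (Suc m))) + smult ?B (orth (Suc m)) + smult ?C (orth m))"
  have D: "degree ?D \<le> Suc (Suc m)" "coeff ?D (Suc (Suc m)) = ?A"
    using degree_pderiv_mult_linear_le[of "orth (Suc m)" "Suc m" 0 0] by simp_all
  have "?T = 0"
  proof (rule eq_0_of_orth)
    show "degree ?T \<le> Suc (Suc m)"
      by (intro degree_diff_le degree_add_le D order.trans[OF degree_smult_le]) auto
    fix i assume i: "i \<le> Suc (Suc m)"
    have LT: "L (orth i * ?T) = L (orth i * ?D) - (?A * L (orth i * orth (Suc (Suc m)))
       + ?B * L (orth i * orth (Suc m)) + ?C * L (orth i * orth m))"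
      unfolding diff_right add_right smult_right ..
    consider "i = Suc (Suc m)" | "i = Suc m" | "i = m" | "i < m" using i by linarith
    then show "L (orth i * ?T) = 0"
    proof cases
      case 1
      then have "L (orth i * ?D) = ?A * sqnorm (Suc (Suc m))"
        using ip_orth_le[of ?D "Suc (Suc m)"] D by (simp only: mult.commute)
      then show ?thesis
        unfolding LT by (simp add: 1 ip_orth_orth flip: sqnorm_def)
    next
      case 2
      have "L (orth i * ?D) = ?B * sqnorm (Suc m)"
        unfolding integration_by_parts 2 by (subst L_linear_sq_orth, simp_all, algebra)
      then show ?thesis
        unfolding LT by (simp add: 2 ip_orth_orth flip: sqnorm_def)
    next
      case 3
      have C: "?C * sqnorm m = (real (Suc m) + 1 + s) * sqnorm (Suc m)"
        by (simp add: rec_b_def)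
      have "L (orth i * ?D) = ?C * sqnorm m"
        unfolding integration_by_parts 3 C by (subst L_linear_sq_orth, simp_all, algebra)
      then show ?thesis
        unfolding LT by (simp add: 3 ip_orth_orth flip: sqnorm_def)
    next
      case 4
      have "L (orth i * ?D) = 0"
        unfolding integration_by_parts by (subst L_linear_sq_orth) (use 4 in auto)
      then show ?thesis
        unfolding LT using 4 by (simp add: ip_orth_orth)
    qed
  qed
  then show ?thesis by simp
qed

text \<open>The coefficient of \<open>x ^ (n - 1)\<close> in \<open>orth n\<close>, with value 0 at
  \<open>n = 0\<close>; the shift by \<open>pCons 0\<close> avoids truncated subtraction.\<close>

definition subcoeff :: "nat \<Rightarrow> real" where
  "subcoeff n = coeff (pCons 0 (orth n)) n"

lemma subcoeff_Suc: "subcoeff (Suc n) = subcoeff n - rec_a n"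
proof (cases n)
  case 0
  then show ?thesis by (simp add: subcoeff_def orth_Suc_0)
next
  case (Suc m)
  show ?thesis
    unfolding Suc subcoeff_def orth_Suc_Suc by (simp add: coeff_eq_0 coeff_pCons)
qed

text \<open>For \<open>n > 0\<close>, compare the coefficients of \<open>x ^ n\<close> in the
  structure relation; for \<open>n = 0\<close>, apply the Pearson equation to the constant
  1.\<close>

lemma rec_a_eq_subcoeff: "rec_a n = (2 * subcoeff n + r) / (2 * real n + s + 2)"
proof (cases n)
  case 0
  have "L ([:r, - (s + 2):] * orth 0 * orth 0) = 0"
    using pearson[of 1] by (simp add: pderiv_1)
  then have "r + - (s + 2) * rec_a 0 = 0"
    unfolding L_linear_orth by simp
  then have "r = (s + 2) * rec_a 0"
    by algebra
  then show ?thesis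
    using params by (simp add: 0 subcoeff_def field_simps)
next
  case (Suc m)
  have "coeff ([:1, 0, -1:] * pderiv (orth (Suc m))) (Suc m) = - real m * subcoeff (Suc m)"
    unfolding coeff_one_minus_square_mult
    by (auto simp: coeff_pderiv coeff_pCons coeff_eq_0 subcoeff_def split: nat.split)
  moreover have "coeff (orth (Suc (Suc m))) (Suc m) = subcoeff (Suc m) - rec_a (Suc m)"
    using subcoeff_Suc[of "Suc m"] by (simp add: subcoeff_def)
  ultimately have "- real m * subcoeff (Suc m) = - real (Suc m) * (subcoeff (Suc m) - rec_a (Suc m))
      - (r - (s + 2) * rec_a (Suc m)) / 2"
    unfolding structure_relation_three_terms by (simp add: coeff_eq_0, simp add: field_simps)
  then have "rec_a (Suc m) * (2 * real n + s + 2) = 2 * subcoeff (Suc m) + r"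
    by (simp add: Suc field_simps)
  then show ?thesis
    using params by (simp add: Suc field_simps)
qed

text \<open>Eliminating \<open>rec_a\<close> from the two preceding relations leaves a first-order
  recursion for \<open>subcoeff\<close> alone.\<close>

lemma subcoeff_eq: "subcoeff (Suc n) = - (real (Suc n) * r / (2 * real (Suc n) + s))"
proof (induction n)
  case 0
  have "subcoeff 0 = 0" by (simp add: subcoeff_def)
  then show ?case
    using params by (simp add: subcoeff_Suc rec_a_eq_subcoeff)
next
  case (Suc n)
  define t where "t = 2 * real (Suc n) + s"
  have t: "t > 0" "2 * real (Suc (Suc n)) + s = t + 2" "2 * real (Suc n) + s + 2 = t + 2" 
    using params by (simp_all add: t_def)
  have n: "real (Suc n) = (t - s) / 2" "real (Suc (Suc n)) = (t - s) / 2 + 1" by (simp_all add: t_def field_simps)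
  show ?case
    unfolding subcoeff_Suc[of "Suc n"] rec_a_eq_subcoeff t Suc.IH t_def[symmetric] n
    using t(1) by (simp add: divide_simps) algebra
qed

text \<open>Indices start at 1: the denominator of \<open>gamma1\<close> at 0 contains the factor
  \<open>s\<close>, which may be 0, whereas \<open>rec_a 0\<close> is
  \<open>r / (s + 2)\<close>.\<close>

lemma rec_a_eq: "rec_a (Suc n) = gamma1 \<alpha> \<beta> (Suc n)"
proof -
  define t where "t = 2 * real (Suc n) + s"
  have t: "t > 0" using params by (simp add: t_def)
  have n: "real (Suc n) = (t - s) / 2" by (simp add: t_def)
  have "rec_a (Suc n) = (2 * - (real (Suc n) * r / t) + r) / (t + 2)"
    unfolding rec_a_eq_subcoeff subcoeff_eq t_def ..
  also have "\<dots> = r * s / (t * (t + 2))"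
    unfolding n using t by (simp add: divide_simps) algebra
  also have "\<dots> = gamma1 \<alpha> \<beta> (Suc n)"
    unfolding gamma1_def t_def by (simp add: power2_eq_square algebra_simps)
  finally show ?thesis .
qed

text \<open>The recurrence removes the highest of the three polynomials;
  \<open>rec_a_eq_subcoeff\<close> identifies the constant term of the linear factor that
  results.\<close>

lemma structure_relation:
  "[:1, 0, -1:] * pderiv (orth (Suc m)) =
     [:subcoeff (Suc m), - real (Suc m):] * orth (Suc m)
     + smult ((2 * real (Suc m) + 1 + s) * rec_b (Suc m)) (orth m)"
proof -
  have "2 * real (Suc m) + s + 2 > 0"
    using params by simp
  then have *: "subcoeff (Suc m) = real (Suc m) * rec_a (Suc m) - (r - (s + 2) * rec_a (Suc m)) / 2"
    using rec_a_eq_subcoeff[of "Suc m"] by (simp add: field_simps)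
  have "smult (- k) ([:- a, 1:] * P - smult b Q) + smult e P + smult f Q
    = [:k * a + e, - k:] * P + smult (f + k * b) Q" for k a b e f and P Q :: "real poly"
    by (intro iffD1[OF poly_eq_poly_eq_iff] ext) (simp add: algebra_simps)
  moreover have "(real (Suc m) + 1 + s) * rec_b (Suc m) + real (Suc m) * rec_b (Suc m)
    = (2 * real (Suc m) + 1 + s) * rec_b (Suc m)"
    by algebra
  ultimately show ?thesis
    unfolding structure_relation_three_terms orth_Suc_Suc * by (simp only: minus_divide_left flip: add_uminus_conv_diff)
qed

definition subsubcoeff :: "nat \<Rightarrow> real" where
  "subsubcoeff n = coeff (pCons 0 (pCons 0 (orth n))) n"

lemma subsubcoeff_Suc:
  "subsubcoeff (Suc (Suc n)) = subsubcoeff (Suc n) - rec_a (Suc n) * subcoeff (Suc n) - rec_b (Suc n)"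
  unfolding subsubcoeff_def subcoeff_def orth_Suc_Suc
  by (simp add: coeff_eq_0 coeff_pCons)

text \<open>Compare the coefficients of \<open>x ^ n\<close> in the structure relation of
  \<open>orth (Suc n)\<close>.\<close>

lemma subsubcoeff_eq:
  "real (Suc n) + 2 * subsubcoeff (Suc n) = (subcoeff (Suc n))\<^sup>2 + (2 * real (Suc n) + 1 + s) * rec_b (Suc n)"
proof -
  have "coeff ([:1, 0, -1:] * pderiv (orth (Suc n))) n = real (Suc n) - (real n - 1) * subsubcoeff (Suc n)"
    unfolding coeff_one_minus_square_mult
    by (auto simp: coeff_pderiv coeff_pCons coeff_eq_0 subsubcoeff_def algebra_simps split: nat.split)
  moreover have "coeff ([:subcoeff (Suc n), - real (Suc n):] * orth (Suc n)) n
      = (subcoeff (Suc n))\<^sup>2 - real (Suc n) * subsubcoeff (Suc n)"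
    by (cases n) (simp_all add: subsubcoeff_def subcoeff_def power2_eq_square algebra_simps)
  ultimately show ?thesis
    unfolding structure_relation by (simp add: algebra_simps)
qed

text \<open>Subtracting two consecutive instances of \<open>subsubcoeff_eq\<close> cancels
  \<open>subsubcoeff\<close> and the mixed terms \<open>rec_a * subcoeff\<close>, so only recurrence
  coefficients remain.\<close>

lemma rec_b_Suc:
  "(2 * real (Suc n) + 3 + s) * rec_b (Suc (Suc n)) =
    (2 * real (Suc n) - 1 + s) * rec_b (Suc n) + 1 - (rec_a (Suc n))\<^sup>2"
proof -
  show ?thesis
    using subsubcoeff_eq[of n] subsubcoeff_eq[of "Suc n", unfolded subcoeff_Suc[of "Suc n"] subsubcoeff_Suc]
    by (simp add: power2_eq_square algebra_simps)
qed

text \<open>Here \<open>subsubcoeff\<close> vanishes, so the coefficient comparison determines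
  \<open>rec_b 1\<close> by itself, directly in the cancelled form of \<open>gamma2\<close>.\<close>

lemma rec_b_1: "rec_b (Suc 0) = gamma2 \<alpha> \<beta> (Suc 0)"
proof -
  have "subsubcoeff (Suc 0) = 0"
    by (simp add: subsubcoeff_def)
  then have *: "(3 + s) * rec_b (Suc 0) = 1 - (r / (2 + s))\<^sup>2"
    using subsubcoeff_eq[of 0] by (simp add: subcoeff_eq algebra_simps)
  have "2 + s > 0" "3 + s > 0" using params by auto
  then have "rec_b (Suc 0) = (1 - (r / (2 + s))\<^sup>2) / (3 + s)"
    using * by (metis less_numeral_extra(3) nonzero_mult_div_cancel_left)
  also have "\<dots> = 4 * (1 + \<alpha>) * (1 + \<beta>) / ((2 + s)\<^sup>2 * (3 + s))"
    using \<open>2 + s > 0\<close> \<open>3 + s > 0\<close> by (simp add: divide_simps) algebra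
  finally show ?thesis
    by (simp add: gamma2_def add.assoc)
qed

text \<open>Multiplied by \<open>2 n + s - 1\<close>, the closed form also holds at \<open>n = 1\<close>, where this factor may vanish.\<close>

lemma rec_b_closed_form:
  assumes "t = 2 * real (Suc n) + s"
  shows "(t - 1) * rec_b (Suc n) = (t\<^sup>2 - s\<^sup>2) * (t\<^sup>2 - r\<^sup>2) / (4 * t\<^sup>2 * (t + 1))"
  using assms
proof (induction n arbitrary: t)
  case 0
  then have t: "t = 2 + s" "t > 0" "s = t - 2"
    using params by auto
  have "rec_b (Suc 0) = (t\<^sup>2 - r\<^sup>2) / (t\<^sup>2 * (t + 1))"
    unfolding rec_b_1 gamma2_def t(1) by (simp add: power2_eq_square algebra_simps)
  then show ?case
    unfolding t(3) using t(2) by (simp add: divide_simps) algebra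
next
  case (Suc n)
  define t' where "t' = 2 * real (Suc n) + s"
  have t: "t = t' + 2" "t' > 0"
    using Suc.prems params by (auto simp: t'_def)
  have "rec_a (Suc n) = r * s / (t' * (t' + 2))"
    unfolding rec_a_eq gamma1_def t'_def by (simp add: power2_eq_square algebra_simps)
  then have "(t' + 3) * rec_b (Suc (Suc n)) = (t' - 1) * rec_b (Suc n) + 1 - (r * s / (t' * (t' + 2)))\<^sup>2"
    using rec_b_Suc[of n] by (simp add: t'_def algebra_simps)
  also have "\<dots> = (t\<^sup>2 - s\<^sup>2) * (t\<^sup>2 - r\<^sup>2) / (4 * t\<^sup>2 * (t' + 1))"
    unfolding Suc.IH[OF t'_def] t(1) by (rule gamma_identity[symmetric]) (use t in auto)
  finally have "rec_b (Suc (Suc n)) = (t\<^sup>2 - s\<^sup>2) * (t\<^sup>2 - r\<^sup>2) / (4 * t\<^sup>2 * (t' + 1)) / (t' + 3)"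
    using t(2) nonzero_mult_div_cancel_left[of "t' + 3" "rec_b (Suc (Suc n))"] by simp
  moreover have "t - 1 = t' + 1" "t + 1 = t' + 3"
    using t by auto
  ultimately show ?case
    using t(2) by (simp only:) simp
qed

lemma rec_b_eq: "rec_b (Suc n) = gamma2 \<alpha> \<beta> (Suc n)"
proof (cases n)
  case 0
  then show ?thesis by (simp add: rec_b_1)
next
  case (Suc m)
  define t where "t = 2 * real (Suc n) + s"
  \<comment> \<open>From index 2 on the factor \<open>t - 1\<close> is positive and can be divided
    out of the closed form.\<close>
  have t: "t - 1 > 0"
    using params by (simp add: t_def Suc)
  have "t\<^sup>2 - s\<^sup>2 = 4 * real (Suc n) * (real (Suc n) + s)"
    "t\<^sup>2 - r\<^sup>2 = 4 * (real (Suc n) + \<alpha>) * (real (Suc n) + \<beta>)"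
    unfolding t_def by (simp_all only: power2_eq_square) algebra+
  then have "(t\<^sup>2 - s\<^sup>2) * (t\<^sup>2 - r\<^sup>2) / (4 * t\<^sup>2 * (t + 1)) =
      (4 * (4 * real (Suc n) * (real (Suc n) + \<alpha>) * (real (Suc n) + \<beta>) * (real (Suc n) + s))) / (4 * (t\<^sup>2 * (t + 1)))"
    by (simp only: mult_ac)
  then have "(t - 1) * rec_b (Suc n) =
      4 * real (Suc n) * (real (Suc n) + \<alpha>) * (real (Suc n) + \<beta>) * (real (Suc n) + s) / (t\<^sup>2 * (t + 1))"
    unfolding rec_b_closed_form[OF t_def] by (simp only: mult_divide_mult_cancel_left)
  then have "rec_b (Suc n) = 4 * real (Suc n) * (real (Suc n) + \<alpha>) * (real (Suc n) + \<beta>) * (real (Suc n) + s)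
      / (t\<^sup>2 * ((t + 1) * (t - 1)))"
    using t nonzero_mult_div_cancel_left[of "t - 1" "rec_b (Suc n)"] by simp
  moreover have "(t + 1) * (t - 1) = t\<^sup>2 - 1"
    by algebra
  ultimately show ?thesis
    by (simp add: gamma2_def Suc t_def add.assoc)
qed

lemma b_hat_eq: "b_hat \<alpha> \<beta> (Suc n) = (2 * real (Suc n) + 1 + s) * rec_b (Suc n)"
proof -
  define t where "t = 2 * real (Suc n) + s"
  have t: "t > 0" "t + 1 > 0" using params by (simp_all add: t_def)
  have "b_hat \<alpha> \<beta> (Suc n) = (t + 1) * gamma2 \<alpha> \<beta> (Suc n)"
  proof (cases n)
    case 0
    then have "3 + \<alpha> + \<beta> = t + 1" by (simp add: t_def)
    then show ?thesis
      unfolding b_hat_def gamma2_def using 0 t by (simp only:) simp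
  next
    case (Suc m)
    then have "t - 1 > 0" using params by (simp add: t_def)
    moreover have "t\<^sup>2 - 1 = (t + 1) * (t - 1)"
      by algebra
    ultimately show ?thesis using t Suc
      unfolding b_hat_def gamma2_def add.assoc t_def[symmetric] by simp
  qed
  then show ?thesis
    by (simp add: t_def rec_b_eq algebra_simps)
qed

section \<open>The derivative formulas with the coefficients \<open>a_hat\<close>,
  \<open>b_hat\<close>, \<open>c_hat\<close>, \<open>d_hat\<close>\<close>

lemma pderiv_orth_hat:
  "[:1, 0, -1:] * pderiv (orth (Suc n)) = a_hat \<alpha> \<beta> (Suc n) * orth (Suc n) + smult (b_hat \<alpha> \<beta> (Suc n)) (orth n)"
proof -
  have "2 * real (Suc n) + s \<noteq> 0"
    using params by simp
  then have "a_hat \<alpha> \<beta> (Suc n) = [:subcoeff (Suc n), - real (Suc n):]"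
    unfolding a_hat_def subcoeff_eq add.assoc by (simp add: divide_simps)
  then show ?thesis
    by (simp only: structure_relation b_hat_eq)
qed

text \<open>The recurrence is now used downwards, to trade \<open>orth (n - 1)\<close> for
  \<open>orth (n + 1)\<close>. At \<open>n = 0\<close> both sides are zero because
  \<open>orth 1 = x - rec_a 0\<close>.\<close>

lemma pderiv_orth_hat':
  "[:1, 0, -1:] * pderiv (orth n) = c_hat \<alpha> \<beta> (Suc n) * orth n + smult (d_hat \<alpha> \<beta> (Suc n)) (orth (Suc n))"
proof (cases n)
  case 0
  have "2 + s \<noteq> 0" using params by simp
  then have "c_hat \<alpha> \<beta> (Suc 0) = smult (1 + s) [:- rec_a 0, 1:]"
    by (simp add: c_hat_def rec_a_eq_subcoeff subcoeff_def field_simps)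
  then show ?thesis
    by (simp add: 0 d_hat_def orth_Suc_0 algebra_simps)
next
  case (Suc m)
  define t where "t = 2 * real (Suc n) + s"
  have t: "t > 2" using params by (simp add: t_def Suc)
  have n: "real (Suc n) = (t - s) / 2" "2 * real n + 1 + s = t - 1" "2 * real n + s = t - 2" "real n = (t - s) / 2 - 1"
    by (simp_all add: t_def field_simps)
  have ra: "rec_a n = r * s / ((t - 2) * t)"
    using rec_a_eq[of m] unfolding gamma1_def Suc[symmetric] by (simp add: t_def power2_eq_square algebra_simps)
  have sc: "subcoeff n = - (real n * r / (t - 2))"
    using subcoeff_eq[of m] unfolding Suc[symmetric] by (simp add: t_def)
  have "subcoeff n - (t - 1) * rec_a n = - (r * ((t - s) / 2 + s) / t)"
    unfolding ra sc n(4) using t by (simp add: divide_simps) algebra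
  then have c: "c_hat \<alpha> \<beta> (Suc n) = [:subcoeff n - (t - 1) * rec_a n, - real n + (t - 1):]"
    using t unfolding c_hat_def add.assoc t_def[symmetric] n(1,4) by (simp add: divide_simps) (simp add: algebra_simps)
  have "smult (rec_b n) (orth m) = [:- rec_a n, 1:] * orth n - orth (Suc n)"
    using orth_Suc_Suc[of m] by (simp add: Suc)
  then have "[:1, 0, -1:] * pderiv (orth n) =
     [:subcoeff n, - real n:] * orth n + smult (t - 1) ([:- rec_a n, 1:] * orth n - orth (Suc n))"
    using structure_relation[of m] unfolding Suc[symmetric] n(2) by (metis smult_smult)
  also have "\<dots> = c_hat \<alpha> \<beta> (Suc n) * orth n + smult (- (t - 1)) (orth (Suc n))"
    unfolding c by (simp add: algebra_simps smult_diff_right smult_add_right smult_add_left smult_diff_left)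
  finally show ?thesis
    unfolding d_hat_def by (simp add: t_def algebra_simps)
qed

end

section \<open>Degrees and top coefficients with integer bounds\<close>

text \<open>Integer bounds avoid a case distinction for \<open>total_d = 0\<close>, where \<open>B2\<close> has degree bound \<open>- 1\<close>.\<close>

definition icoeff :: "'a::zero poly \<Rightarrow> int \<Rightarrow> 'a" where
  "icoeff p k = (if k < 0 then 0 else coeff p (nat k))"

definition deg_le :: "'a::zero poly \<Rightarrow> int \<Rightarrow> bool" where
  "deg_le p k \<longleftrightarrow> (\<forall>i. int i > k \<longrightarrow> coeff p i = 0)"

lemma deg_le_mono: "deg_le p k \<Longrightarrow> k \<le> l \<Longrightarrow> deg_le p l"
  by (auto simp: deg_le_def)

lemma deg_le_degree: "degree p \<le> n \<Longrightarrow> deg_le p (int n)"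
  by (simp add: deg_le_def coeff_eq_0)

lemma degree_le_of_deg_le: "deg_le p (int n) \<Longrightarrow> degree p \<le> n"
  by (auto simp: deg_le_def intro!: degree_le)

lemma deg_le_neg: "deg_le p k \<Longrightarrow> k < 0 \<Longrightarrow> p = 0"
  by (auto simp: deg_le_def intro!: poly_eqI)

lemma deg_le_add: "deg_le p k \<Longrightarrow> deg_le q k \<Longrightarrow> deg_le (p + q) k"
  by (simp add: deg_le_def)

lemma deg_le_diff: "deg_le p k \<Longrightarrow> deg_le q k \<Longrightarrow> deg_le (p - q) k"
  for p q :: "'a::ab_group_add poly"
  by (simp add: deg_le_def)

lemma deg_le_uminus: "deg_le p k \<Longrightarrow> deg_le (- p) k"
  for p :: "'a::ab_group_add poly"
  by (simp add: deg_le_def)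

lemma deg_le_smult: "deg_le p k \<Longrightarrow> deg_le (smult a p) k"
  by (simp add: deg_le_def)

lemma deg_le_sum: "(\<And>x. x \<in> A \<Longrightarrow> deg_le (f x) k) \<Longrightarrow> deg_le (\<Sum>x\<in>A. f x) k"
  by (simp add: deg_le_def coeff_sum)

lemma deg_le_pderiv: "deg_le p k \<Longrightarrow> deg_le (pderiv p) (k - 1)"
  by (simp add: deg_le_def coeff_pderiv)

lemma deg_le_mult:
  fixes p q :: "'a::comm_semiring_0 poly"
  assumes "deg_le p a" "deg_le q b" "a + b \<le> k"
  shows "deg_le (p * q) k"
  unfolding deg_le_def coeff_mult
proof (intro allI impI sum.neutral ballI)
  fix i j assume "k < int i" "j \<in> {..i}"
  then have "int j > a \<or> int (i - j) > b"
    using assms(3) by auto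
  then show "coeff p j * coeff q (i - j) = 0"
    using assms by (auto simp: deg_le_def)
qed

lemma icoeff_add: "icoeff (p + q) k = icoeff p k + icoeff q k"
  by (simp add: icoeff_def)

lemma icoeff_diff: "icoeff (p - q) k = icoeff p k - icoeff q k"
  for p q :: "'a::ab_group_add poly"
  by (simp add: icoeff_def)

lemma icoeff_smult: "icoeff (smult a p) k = a * icoeff p k"
  by (simp add: icoeff_def)

lemma icoeff_sum: "icoeff (\<Sum>x\<in>A. f x) k = (\<Sum>x\<in>A. icoeff (f x) k)"
  by (simp add: icoeff_def coeff_sum)

lemma icoeff_eq_0: "deg_le p k \<Longrightarrow> k < l \<Longrightarrow> icoeff p l = 0"
  by (auto simp: deg_le_def icoeff_def)

text \<open>Valid for every integer: at \<open>k = 0\<close> the factor vanishes, and for negative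
  \<open>k\<close> both coefficients do.\<close>

lemma icoeff_pderiv: "icoeff (pderiv p) (k - 1) = of_int k * icoeff p k"
  for p :: "real poly"
proof (cases "k \<ge> 1")
  case True
  then have "Suc (nat (k - 1)) = nat k" "real (nat k) = of_int k"
    by auto
  with True show ?thesis
    by (simp add: icoeff_def coeff_pderiv del: of_nat_Suc)
qed (auto simp: icoeff_def)

lemma icoeff_mult:
  fixes p q :: "real poly"
  assumes "deg_le p a" "deg_le q b" "k = a + b"
  shows "icoeff (p * q) k = icoeff p a * icoeff q b"
\<comment> \<open>A negative bound makes one factor zero, and then both sides vanish.\<close>
proof (cases "a < 0 \<or> b < 0")
  case True
  then have "p = 0 \<or> q = 0"
    using assms deg_le_neg by blast
  with True show ?thesis
    by (auto simp: icoeff_def)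
next
  case False
  then obtain m n where mn: "a = int m" "b = int n"
    by (metis nonneg_int_cases not_less)
  then have deg: "degree p \<le> m" "degree q \<le> n"
    using assms degree_le_of_deg_le by auto
  have "coeff (p * q) (m + n) = coeff p m * coeff q n"
  proof (cases "degree p = m \<and> degree q = n")
    case True
    then show ?thesis
      using coeff_mult_degree_sum[of p q] by auto
  next
    case False
    with deg have "degree p < m \<or> degree q < n" "degree (p * q) < m + n"
      using degree_mult_le[of p q] by auto
    then show ?thesis
      by (auto simp: coeff_eq_0)
  qed
  moreover have "nat (int m + int n) = m + n"
    by simp
  ultimately show ?thesis
    by (simp add: icoeff_def mn assms(3) del: nat_int_add)
qed

lemma degree_eq_of_icoeff: "deg_le p (int n) \<Longrightarrow> icoeff p (int n) \<noteq> 0 \<Longrightarrow> degree p = n"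
  using degree_le_of_deg_le[of p n] le_degree[of p n] by (auto simp: icoeff_def intro: antisym)

lemma taylor_Q_deg_le: "deg_le (taylor_Q k a p) (int k)"
  unfolding taylor_Q_eq
  by (intro deg_le_sum deg_le_smult deg_le_mono[OF deg_le_degree[OF order.refl]])
    (simp add: degree_linear_power)

lemma icoeff_taylor_Q: "icoeff (taylor_Q k a p) (int k) = taylor_coeff k a p"
proof -
  have "coeff ([:- a, 1:] ^ k) k = 1"
    using lead_coeff_power[of "[:- a, 1:]" k] by (simp add: degree_linear_power)
  moreover have "coeff ([:- a, 1:] ^ i) k = 0" if "i < k" for i
    using that by (simp add: coeff_eq_0 degree_linear_power)
  ultimately have "(\<Sum>i\<le>k. taylor_coeff i a p * coeff ([:- a, 1:] ^ i) k) =
      (\<Sum>i\<le>k. if i = k then taylor_coeff k a p else 0)"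
    by (intro sum.cong) auto
  then show ?thesis
    by (simp add: icoeff_def taylor_Q_eq coeff_sum)
qed

section \<open>Jacobi--Sobolev polynomials\<close>

text \<open>Multiplying by powers of \<open>q1\<close> eliminates \<open>g\<close> without a division, so \<open>q1\<close> may vanish.\<close>

lemma eliminate_first_order_system:
  fixes f g q0 q1 q2 q3 q4 :: "real poly"
  assumes 1: "q0 * pderiv f + q2 * f = q1 * g"
    and 2: "q0 * pderiv g + q3 * g = q4 * f"
  shows "q1 * q0\<^sup>2 * pderiv (pderiv f)
    + q0 * (q1 * q2 + q1 * q3 + pderiv q0 * q1 - q0 * pderiv q1) * pderiv f
    + (q1 * q2 * q3 + q0 * (pderiv q2 * q1 - q2 * pderiv q1) - q4 * q1\<^sup>2) * f = 0"
proof -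
  have "pderiv (q0 * pderiv f + q2 * f) = pderiv (q1 * g)"
    by (simp only: 1)
  then have "q0 * pderiv (pderiv f) + pderiv q0 * pderiv f + q2 * pderiv f + pderiv q2 * f
      = q1 * pderiv g + pderiv q1 * g"
    unfolding pderiv_add pderiv_mult by (simp add: algebra_simps)
  \<comment> \<open>Multiply the differentiated equation by \<open>q0 * q1\<close>, replace
    \<open>q0 * pderiv g\<close> by the second equation, and then every \<open>q1 * g\<close> by the
    first.\<close>
  with 1 2 show ?thesis
    by algebra
qed

text \<open>Cramer's rule for \<open>p\<close> and \<open>q\<close>. After multiplication of the
  derivative formula by the determinant, every term contains \<open>\<rho>\<close>: the one with
  \<open>pderiv \<rho>\<close> gets it from the determinant being \<open>\<rho> * \<delta>\<close>.
  Cancelling it is what leaves \<open>\<delta>\<close> in the coefficients.\<close>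

lemma first_order_system:
  fixes f g w \<rho> \<delta> a b a' b' c e c' e' p q :: "real poly"
  assumes f: "\<rho> * f = a * p + b * q" "w * pderiv (\<rho> * f) = a' * p + b' * q"
    and g: "\<rho> * g = c * p + e * q" "w * pderiv (\<rho> * g) = c' * p + e' * q"
    and \<delta>: "a * e - c * b = \<rho> * \<delta>" and "\<rho> \<noteq> 0"
  shows "w * (a * e - c * b) * pderiv f + (w * pderiv \<rho> * \<delta> + b' * c - a' * e) * f = (b' * a - a' * b) * g"
    and "w * (a * e - c * b) * pderiv g + (w * pderiv \<rho> * \<delta> + c' * b - e' * a) * g = (c' * e - e' * c) * f"
proof -
  have fg': "w * (\<rho> * pderiv f + pderiv \<rho> * f) = a' * p + b' * q"
    "w * (\<rho> * pderiv g + pderiv \<rho> * g) = c' * p + e' * q"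
    using f(2) g(2) by (simp_all add: pderiv_mult algebra_simps)
  have pq: "(a * e - c * b) * p = \<rho> * (e * f - b * g)" "(a * e - c * b) * q = \<rho> * (a * g - c * f)"
    using f(1) g(1) by algebra+
  have "\<rho> * (w * (a * e - c * b) * pderiv f + (w * pderiv \<rho> * \<delta> + b' * c - a' * e) * f)
      = \<rho> * ((b' * a - a' * b) * g)"
    using fg'(1) pq \<delta> by algebra
  then show "w * (a * e - c * b) * pderiv f + (w * pderiv \<rho> * \<delta> + b' * c - a' * e) * f = (b' * a - a' * b) * g"
    using \<open>\<rho> \<noteq> 0\<close> by simp
  have "\<rho> * (w * (a * e - c * b) * pderiv g + (w * pderiv \<rho> * \<delta> + c' * b - e' * a) * g)
      = \<rho> * ((c' * e - e' * c) * f)"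
    using fg'(2) pq \<delta> by algebra
  then show "w * (a * e - c * b) * pderiv g + (w * pderiv \<rho> * \<delta> + c' * b - e' * a) * g = (c' * e - e' * c) * f"
    using \<open>\<rho> \<noteq> 0\<close> by simp
qed

locale jacobi_sobolev =
  fixes \<alpha> \<beta> :: real and N :: nat and d :: "nat \<Rightarrow> nat" and lam :: "nat \<Rightarrow> nat \<Rightarrow> real" and c :: "nat \<Rightarrow> real"
  assumes alpha: "\<alpha> > -1" and beta: "\<beta> > -1"
begin

sublocale J: pearson_functional "jacobi_functional \<alpha> \<beta>" \<alpha> \<beta>
proof unfold_locales
  show "jacobi_functional \<alpha> \<beta> ([:1, 0, -1:] * pderiv p + [:\<beta> - \<alpha>, - (\<alpha> + \<beta> + 2):] * p) = 0" for p
    by (rule jacobi_functional_pearson[OF alpha beta])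
qed (simp_all add: alpha beta jacobi_functional_add jacobi_functional_smult jacobi_functional_pos)

abbreviation "L \<equiv> jacobi_functional \<alpha> \<beta>"
abbreviation "P \<equiv> jacobi_poly \<alpha> \<beta>"
abbreviation "h \<equiv> jacobi_h \<alpha> \<beta>"
abbreviation "I \<equiv> Iplus N d lam"
abbreviation "S \<equiv> sobolev_poly \<alpha> \<beta> N d lam c"
abbreviation "R \<equiv> rho N d c"
abbreviation "D \<equiv> int (total_d N d)"

lemma P_eq: "P n = J.orth n"
proof -
  have "jacobi_ip \<alpha> \<beta> = (\<lambda>p q. L (p * q))"
    by (intro ext jacobi_ip_eq_functional)
  then show ?thesis
    by (simp add: jacobi_poly_def J.orth_def)
qed

lemma h_eq: "h n = J.sqnorm n"
  using integral_jacobi_measure[where p = "P n * P n"]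
  by (simp add: jacobi_h_def J.sqnorm_def P_eq power2_eq_square)

lemma h_pos: "h n > 0"
  by (simp add: h_eq)

section \<open>The Sobolev product as the Jacobi product plus a point part\<close>

definition point_ip :: "real poly \<Rightarrow> real poly \<Rightarrow> real" where
  "point_ip f g = (\<Sum>(j, k)\<in>I. lam j k * poly ((pderiv ^^ k) f) (c j) * poly ((pderiv ^^ k) g) (c j))"

lemma sobolev_ip_eq: "sobolev_ip \<alpha> \<beta> N d lam c f g = L (f * g) + point_ip f g"
  by (simp add: sobolev_ip_def point_ip_def jacobi_ip_eq_functional)

lemma point_ip_nonneg: "point_ip f f \<ge> 0"
  unfolding point_ip_def by (intro sum_nonneg) (auto simp: Iplus_def mult.assoc)

sublocale S: poly_inner_product "sobolev_ip \<alpha> \<beta> N d lam c"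
proof unfold_locales
  fix p q r :: "real poly" and a :: real
  show "sobolev_ip \<alpha> \<beta> N d lam c (p + q) r = sobolev_ip \<alpha> \<beta> N d lam c p r + sobolev_ip \<alpha> \<beta> N d lam c q r"
    unfolding sobolev_ip_eq point_ip_def
    by (simp add: J.L_add distrib_right higher_pderiv_add sum.distrib[symmetric] case_prod_unfold algebra_simps)
  show "sobolev_ip \<alpha> \<beta> N d lam c (smult a p) r = a * sobolev_ip \<alpha> \<beta> N d lam c p r"
    unfolding sobolev_ip_eq point_ip_def J.smult_left
    by (simp add: higher_pderiv_smult sum_distrib_left case_prod_unfold algebra_simps)
  show "sobolev_ip \<alpha> \<beta> N d lam c p q = sobolev_ip \<alpha> \<beta> N d lam c q p"
    unfolding sobolev_ip_eq point_ip_def by (simp add: mult_ac)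
  show "sobolev_ip \<alpha> \<beta> N d lam c p p > 0" if "p \<noteq> 0"
    unfolding sobolev_ip_eq using J.pos[OF that] point_ip_nonneg[of p] by simp
qed

lemma S_eq: "S n = S.orth n"
  by (simp add: sobolev_poly_def S.orth_def)

lemma L_orth_S: "degree q < n \<Longrightarrow> L (q * S n) = - point_ip q (S n)"
  using S.ip_orth_lower[of q n] by (simp add: S_eq sobolev_ip_eq)

text \<open>The reproducing property of the kernel, differentiated in \<open>y\<close>.\<close>

lemma L_orth_kernel:
  assumes "i < n"
  shows "L (J.orth i * J.kernel_coeff k a n) = taylor_coeff k a (J.orth i)"
proof -
  have "L (J.orth i * J.kernel_coeff k a n) = (\<Sum>l<n. if l = i then taylor_coeff k a (J.orth i) else 0)"
    unfolding J.kernel_coeff_def J.sum_right J.smult_right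
  proof (rule sum.cong[OF refl])
    fix l
    show "taylor_coeff k a (J.orth l) / J.sqnorm l * L (J.orth i * J.orth l)
        = (if l = i then taylor_coeff k a (J.orth i) else 0)"
      using J.ip_orth_orth[of i l] by (auto simp flip: J.sqnorm_def)
  qed
  then show ?thesis
    using assms by simp
qed

text \<open>The factor \<open>fact k\<close> offsets the division in \<open>taylor_coeff\<close>, so
  that the point part of a product with \<open>S n\<close> is a combination of Taylor
  coefficients.\<close>

definition weight :: "nat \<Rightarrow> nat \<Rightarrow> nat \<Rightarrow> real" where
  "weight n j k = fact k * lam j k * poly ((pderiv ^^ k) (S n)) (c j)"

lemma point_ip_S: "point_ip f (S n) = (\<Sum>(j, k)\<in>I. weight n j k * taylor_coeff k (c j) f)"
  unfolding point_ip_def weight_def taylor_coeff_def by (simp add: mult_ac)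

text \<open>Orthogonality of \<open>S n\<close> gives its Jacobi product with a lower
  \<open>P i\<close> as minus a combination of Taylor coefficients of \<open>P i\<close>, and the
  kernel reproduces exactly these. The leading terms of the two monic polynomials cancel, which
  gives the degree bound on \<open>?T\<close>.\<close>

lemma S_expansion:
  "S (Suc m) = P (Suc m) - (\<Sum>(j, k)\<in>I. smult (weight (Suc m) j k) (J.kernel_coeff k (c j) (Suc m)))"
proof -
  let ?K = "\<Sum>(j, k)\<in>I. smult (weight (Suc m) j k) (J.kernel_coeff k (c j) (Suc m))"
  let ?T = "S.orth (Suc m) - J.orth (Suc m) + ?K"
  have K: "coeff (J.kernel_coeff k a (Suc m)) i = 0" if "i > m" for i k a
    unfolding J.kernel_coeff_def coeff_sum using that by (intro sum.neutral) (auto simp: coeff_eq_0)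
  have "coeff ?T i = 0" if "i > m" for i
  proof -
    have "coeff ?K i = 0"
      unfolding coeff_sum using that K by (intro sum.neutral) auto
    moreover have "coeff (S.orth (Suc m)) i = coeff (J.orth (Suc m)) i"
      using that by (cases "i = Suc m") (auto simp: coeff_eq_0)
    ultimately show ?thesis by (simp del: coeff_sum)
  qed
  then have deg: "degree ?T \<le> m"
    by (intro degree_le) auto
  have "?T = 0"
  proof (rule J.eq_0_of_orth[OF _ deg])
    fix i assume i: "i \<le> m"
    have "L (J.orth i * ?K) = (\<Sum>(j, k)\<in>I. weight (Suc m) j k * taylor_coeff k (c j) (J.orth i))"
      unfolding J.sum_right case_prod_unfold J.smult_right using i by (simp add: L_orth_kernel)
    moreover have "L (J.orth i * S.orth (Suc m)) = - point_ip (J.orth i) (S (Suc m))"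
      using L_orth_S[of "J.orth i" "Suc m"] i by (simp add: S_eq)
    moreover have "L (J.orth i * J.orth (Suc m)) = 0"
      using i by (intro J.ip_orth_orth) auto
    ultimately show "L (J.orth i * ?T) = 0"
      unfolding J.add_right J.diff_right by (simp add: point_ip_S)
  qed
  then show ?thesis
    by (simp add: S_eq P_eq algebra_simps)
qed

section \<open>The expressions for \<open>rho * S n\<close> and its derivative through two Jacobi
  polynomials\<close>

lemma R_nonzero: "R \<noteq> 0"
  by (auto simp: rho_def simp del: power_Suc)

lemma degree_R: "degree R = total_d N d"
  unfolding rho_def total_d_def
  by (subst degree_prod_eq_sum_degree) (auto simp: degree_linear_power simp del: power_Suc)

lemma lead_coeff_R: "lead_coeff R = 1"
  unfolding rho_def by (simp add: lead_coeff_prod lead_coeff_power del: power_Suc)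

lemma R_split:
  assumes "(j, k) \<in> I"
  shows "R = [:- c j, 1:] ^ Suc k * rho_jk N d c j k"
proof -
  have j: "j \<in> {1..N}" "Suc k \<le> d j + 1"
    using assms by (auto simp: Iplus_def)
  have "[:- c j, 1:] ^ Suc k dvd [:- c j, 1:] ^ (d j + 1)"
    using j(2) by (rule le_imp_power_dvd)
  also have "\<dots> dvd R"
    unfolding rho_def using j(1) by (intro dvd_prodI) auto
  finally show ?thesis
    by (simp add: rho_jk_def)
qed

lemma deg_le_R: "deg_le R D"
  by (intro deg_le_degree) (simp add: degree_R)

lemma icoeff_R: "icoeff R D = 1"
  using lead_coeff_R by (simp add: icoeff_def degree_R)

lemma rho_jk_top:
  assumes "(j, k) \<in> I"
  shows "deg_le (rho_jk N d c j k) (D - int k - 1)" "icoeff (rho_jk N d c j k) (D - int k - 1) = 1"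
proof -
  let ?r = "rho_jk N d c j k"
  have nz: "?r \<noteq> 0"
    using R_split[OF assms] R_nonzero by auto
  have deg: "total_d N d = Suc k + degree ?r"
    using arg_cong[OF R_split[OF assms], of degree] nz
    by (simp add: degree_R degree_mult_eq degree_linear_power del: power_Suc)
  then have D: "D - int k - 1 = int (degree ?r)"
    by simp
  have "lead_coeff ?r = 1"
    using arg_cong[OF R_split[OF assms], of lead_coeff]
    by (simp only: lead_coeff_R lead_coeff_mult lead_coeff_power) simp
  then show "deg_le ?r (D - int k - 1)" "icoeff ?r (D - int k - 1) = 1"
    unfolding D by (auto simp: icoeff_def intro: deg_le_degree)
qed

lemma A2_eq: "A2 \<alpha> \<beta> N d lam c n = R - (\<Sum>(j, k)\<in>I. smult (weight n j k / h (n - 1))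
    (taylor_Q k (c j) (P (n - 1)) * rho_jk N d c j k))"
  by (simp add: A2_def weight_def)

lemma B2_eq: "B2 \<alpha> \<beta> N d lam c n = (\<Sum>(j, k)\<in>I. smult (weight n j k / h (n - 1))
    (taylor_Q k (c j) (P n) * rho_jk N d c j k))"
  by (simp add: B2_def weight_def)

text \<open>The factor \<open>rho\<close> supplies the power of \<open>x - c j\<close> that the
  Christoffel-Darboux formula demands in each term and leaves \<open>rho_jk\<close> as
  cofactor.\<close>

lemma R_S:
  "R * S (Suc m) = A2 \<alpha> \<beta> N d lam c (Suc m) * P (Suc m) + B2 \<alpha> \<beta> N d lam c (Suc m) * P m"
proof -
  have step: "R * smult (weight (Suc m) j k) (J.kernel_coeff k (c j) (Suc m)) =
     smult (weight (Suc m) j k / h m) (taylor_Q k (c j) (P m) * rho_jk N d c j k) * P (Suc m)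
     - smult (weight (Suc m) j k / h m) (taylor_Q k (c j) (P (Suc m)) * rho_jk N d c j k) * P m"
    if "(j, k) \<in> I" for j k
  proof -
    have "R * smult (weight (Suc m) j k) (J.kernel_coeff k (c j) (Suc m)) =
      smult (weight (Suc m) j k / h m) (rho_jk N d c j k *
        smult (h m) ([:- c j, 1:] ^ Suc k * J.kernel_coeff k (c j) (Suc m)))"
      using h_pos[of m] unfolding R_split[OF that] by (simp add: mult_ac del: power_Suc)
    also have "smult (h m) ([:- c j, 1:] ^ Suc k * J.kernel_coeff k (c j) (Suc m))
      = taylor_Q k (c j) (P m) * P (Suc m) - taylor_Q k (c j) (P (Suc m)) * P m"
      unfolding h_eq P_eq by (rule J.christoffel_darboux_taylor)
    finally show ?thesis
      by (simp add: algebra_simps smult_diff_right)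
  qed
  have "R * S (Suc m) = R * P (Suc m) - (\<Sum>(j, k)\<in>I. R * smult (weight (Suc m) j k) (J.kernel_coeff k (c j) (Suc m)))"
    unfolding S_expansion by (simp add: right_diff_distrib sum_distrib_left case_prod_unfold)
  also have "\<dots> = R * P (Suc m) - (\<Sum>(j, k)\<in>I.
      smult (weight (Suc m) j k / h m) (taylor_Q k (c j) (P m) * rho_jk N d c j k) * P (Suc m)
      - smult (weight (Suc m) j k / h m) (taylor_Q k (c j) (P (Suc m)) * rho_jk N d c j k) * P m)"
    using step by (intro arg_cong2[where f = "(-)"] sum.cong) auto
  also have "\<dots> = A2 \<alpha> \<beta> N d lam c (Suc m) * P (Suc m) + B2 \<alpha> \<beta> N d lam c (Suc m) * P m"
    unfolding A2_eq B2_eq case_prod_unfold sum_subtractf left_diff_distrib sum_distrib_right by simp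
  finally show ?thesis .
qed

text \<open>The structure relations stay within the same pair of Jacobi polynomials;
  \<open>A3\<close> and \<open>B3\<close> collect the resulting coefficients.\<close>

lemma pderiv_R_S:
  "[:1, 0, -1:] * pderiv (R * S (Suc m)) =
    A3 \<alpha> \<beta> N d lam c (Suc m) * P (Suc m) + B3 \<alpha> \<beta> N d lam c (Suc m) * P m"
proof -
  define W where "W = [:1, 0, -1 :: real:]"
  define A B where "A = A2 \<alpha> \<beta> N d lam c (Suc m)" and "B = B2 \<alpha> \<beta> N d lam c (Suc m)"
  have P1: "W * pderiv (P (Suc m)) = a_hat \<alpha> \<beta> (Suc m) * P (Suc m) + smult (b_hat \<alpha> \<beta> (Suc m)) (P m)"
    and P2: "W * pderiv (P m) = c_hat \<alpha> \<beta> (Suc m) * P m + smult (d_hat \<alpha> \<beta> (Suc m)) (P (Suc m))"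
    unfolding W_def P_eq by (rule J.pderiv_orth_hat J.pderiv_orth_hat')+
  have "W * pderiv (R * S (Suc m)) = A * (W * pderiv (P (Suc m))) + W * pderiv A * P (Suc m)
      + B * (W * pderiv (P m)) + W * pderiv B * P m"
    unfolding R_S A_def[symmetric] B_def[symmetric] pderiv_add pderiv_mult by algebra
  then show ?thesis
    unfolding P1 P2 A3_def B3_def A_def[symmetric] B_def[symmetric] W_def[symmetric]
    by (simp add: algebra_simps)
qed

section \<open>Passage to the index \<open>n - 1\<close> and division of the determinant by
  \<open>rho\<close>\<close>

lemma gamma2_pos: "gamma2 \<alpha> \<beta> (Suc m) > 0"
  unfolding J.rec_b_eq[symmetric] by (rule J.rec_b_pos)

lemma P_recurrence:
  "P m = smult (1 / gamma2 \<alpha> \<beta> (Suc m)) ([:- gamma1 \<alpha> \<beta> (Suc m), 1:] * P (Suc m) - P (Suc (Suc m)))"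
  using gamma2_pos[of m]
  unfolding P_eq J.orth_Suc_Suc[of m] J.rec_b_eq J.rec_a_eq by simp

text \<open>At index \<open>n - 1\<close> the pair would be \<open>P (n - 1)\<close>,
  \<open>P (n - 2)\<close>. The backward recurrence replaces \<open>P (n - 2)\<close> and so
  produces \<open>C2\<close>, \<open>D2\<close>, \<open>C3\<close>, \<open>D3\<close>.\<close>

lemma R_S':
  fixes m
  defines "n \<equiv> Suc (Suc m)"
  shows "R * S (Suc m) = C2 \<alpha> \<beta> N d lam c n * P n + D2 \<alpha> \<beta> N d lam c n * P (Suc m)"
    and "[:1, 0, -1:] * pderiv (R * S (Suc m)) = C3 \<alpha> \<beta> N d lam c n * P n + D3 \<alpha> \<beta> N d lam c n * P (Suc m)"
proof -
  have rw: "A * P (Suc m) + B * P m = - smult (1 / gamma2 \<alpha> \<beta> (Suc m)) B * P n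
      + (A + smult (1 / gamma2 \<alpha> \<beta> (Suc m)) (B * [:- gamma1 \<alpha> \<beta> (Suc m), 1:])) * P (Suc m)" for A B
    unfolding n_def by (subst P_recurrence) (simp add: algebra_simps smult_diff_right smult_add_right del: mult_pCons_left mult_pCons_right)
  show "R * S (Suc m) = C2 \<alpha> \<beta> N d lam c n * P n + D2 \<alpha> \<beta> N d lam c n * P (Suc m)"
    unfolding R_S rw C2_def D2_def by (simp add: n_def)
  show "[:1, 0, -1:] * pderiv (R * S (Suc m)) = C3 \<alpha> \<beta> N d lam c n * P n + D3 \<alpha> \<beta> N d lam c n * P (Suc m)"
    unfolding pderiv_R_S rw C3_def D3_def by (simp add: n_def)
qed

text \<open>Divisibility passes down the three-term recurrence from \<open>P n, P (n - 1)\<close> to \<open>P 0 = 1\<close>.\<close>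

lemma dvd_of_dvd_mult_P:
  assumes "q dvd p * P (Suc m)" "q dvd p * P m"
  shows "q dvd p"
  using assms
proof (induction m)
  case 0
  then show ?case by (simp add: P_eq)
next
  case (Suc m)
  have "p * P m = smult (1 / gamma2 \<alpha> \<beta> (Suc m))
     ([:- gamma1 \<alpha> \<beta> (Suc m), 1:] * (p * P (Suc m)) - p * P (Suc (Suc m)))"
    by (subst P_recurrence) (simp add: algebra_simps smult_diff_right del: mult_pCons_left mult_pCons_right)
  then have "q dvd p * P m"
    using Suc.prems by (simp only:) (intro dvd_smult dvd_diff dvd_mult[of q "p * P (Suc m)"])
  with Suc show ?case by blast
qed

text \<open>By Cramer's rule \<open>Delta\<close> times each of two consecutive Jacobi polynomials
  is a multiple of \<open>rho\<close>, and these two polynomials have no common factor.\<close>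

lemma Delta_eq: "Delta \<alpha> \<beta> N d lam c (Suc (Suc m)) = R * delta \<alpha> \<beta> N d lam c (Suc (Suc m))"
proof -
  let ?n = "Suc (Suc m)"
  have PP: "Delta \<alpha> \<beta> N d lam c ?n * P ?n = R * (D2 \<alpha> \<beta> N d lam c ?n * S ?n - B2 \<alpha> \<beta> N d lam c ?n * S (Suc m))"
    "Delta \<alpha> \<beta> N d lam c ?n * P (Suc m) = R * (A2 \<alpha> \<beta> N d lam c ?n * S (Suc m) - C2 \<alpha> \<beta> N d lam c ?n * S ?n)"
    using R_S[of "Suc m"] R_S'(1)[of m] unfolding Delta_def by algebra+
  have "R dvd Delta \<alpha> \<beta> N d lam c ?n"
    by (rule dvd_of_dvd_mult_P[of R _ "Suc m"]) (simp_all only: PP dvd_triv_left)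
  then show ?thesis
    by (simp add: delta_def)
qed

lemma ode:
  fixes m
  defines "n \<equiv> Suc (Suc m)"
  shows "ode_P2 \<alpha> \<beta> N d lam c n * pderiv (pderiv (S n)) + ode_P1 \<alpha> \<beta> N d lam c n * pderiv (S n)
    + ode_P0 \<alpha> \<beta> N d lam c n * S n = 0"
proof -
  have "A2 \<alpha> \<beta> N d lam c n * D2 \<alpha> \<beta> N d lam c n - C2 \<alpha> \<beta> N d lam c n * B2 \<alpha> \<beta> N d lam c n
      = R * delta \<alpha> \<beta> N d lam c n"
    using Delta_eq[of m] unfolding n_def Delta_def .
  note sys = first_order_system[OF R_S[of "Suc m", folded n_def] pderiv_R_S[of "Suc m", folded n_def]
      R_S'[of m, folded n_def] this R_nonzero]
  show ?thesis
    unfolding ode_P2_def ode_P1_def ode_P0_def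
    by (rule eliminate_first_order_system[where g = "S (Suc m)"])
      (use sys in \<open>simp_all only: q0_def q1_def q2_def q3_def q4_def Delta_def\<close>)
qed

section \<open>Degrees of the coefficients\<close>

text \<open>Each summand of the correction has degree at most
  \<open>k + (D - k - 1) = D - 1\<close>, so only \<open>rho\<close> reaches
  \<open>D\<close>.\<close>

lemma A2_top:
  "deg_le (A2 \<alpha> \<beta> N d lam c n) D" "icoeff (A2 \<alpha> \<beta> N d lam c n) D = 1"
proof -
  let ?s = "\<Sum>(j, k)\<in>I. smult (weight n j k / h (n - 1)) (taylor_Q k (c j) (P (n - 1)) * rho_jk N d c j k)"
  have s: "deg_le ?s (D - 1)"
    by (intro deg_le_sum) (auto intro!: deg_le_smult deg_le_mult[OF taylor_Q_deg_le rho_jk_top(1)])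
  then show "deg_le (A2 \<alpha> \<beta> N d lam c n) D"
    unfolding A2_eq by (intro deg_le_diff deg_le_R) (auto elim: deg_le_mono)
  show "icoeff (A2 \<alpha> \<beta> N d lam c n) D = 1"
    unfolding A2_eq icoeff_diff using icoeff_R icoeff_eq_0[OF s, of D] by simp
qed

definition B2_top_coeff :: "nat \<Rightarrow> real" where
  "B2_top_coeff n = icoeff (B2 \<alpha> \<beta> N d lam c n) (D - 1)"

lemma B2_top: "deg_le (B2 \<alpha> \<beta> N d lam c n) (D - 1)"
  unfolding B2_eq
  by (intro deg_le_sum) (auto intro!: deg_le_smult deg_le_mult[OF taylor_Q_deg_le rho_jk_top(1)])

text \<open>The top coefficient of \<open>B2\<close> is \<open>(\<parallel>S n\<parallel>\<^sup>2 - h n) / h (n - 1)\<close>, with the Sobolev norm of \<open>S n\<close>;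
  extremality of \<open>P n\<close> makes it nonnegative.\<close>

lemma B2_top_coeff_nonneg: "B2_top_coeff n \<ge> 0"
proof -
  have "B2_top_coeff n = (\<Sum>(j, k)\<in>I. weight n j k / h (n - 1) * taylor_coeff k (c j) (P n))"
    unfolding B2_top_coeff_def B2_eq icoeff_sum
  proof (intro sum.cong refl, clarify)
    fix j k assume jk: "(j, k) \<in> I"
    have "icoeff (taylor_Q k (c j) (P n) * rho_jk N d c j k) (D - 1) = taylor_coeff k (c j) (P n)"
      using rho_jk_top[OF jk] by (subst icoeff_mult[OF taylor_Q_deg_le]) (auto simp: icoeff_taylor_Q)
    then show "icoeff (smult (weight n j k / h (n - 1)) (taylor_Q k (c j) (P n) * rho_jk N d c j k)) (D - 1)
      = weight n j k / h (n - 1) * taylor_coeff k (c j) (P n)"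
      by (simp add: icoeff_smult)
  qed
  also have "\<dots> = point_ip (P n) (S n) / h (n - 1)"
    by (simp add: point_ip_S sum_divide_distrib case_prod_unfold)
  finally have B: "B2_top_coeff n = point_ip (P n) (S n) / h (n - 1)" .
  \<comment> \<open>As \<open>P n\<close> is monic, its Sobolev product with \<open>S n\<close> is
    the squared Sobolev norm of \<open>S n\<close>; as \<open>S n\<close> is monic, their Jacobi
    product is \<open>h n\<close>. The point part is the difference.\<close>
  have "sobolev_ip \<alpha> \<beta> N d lam c (P n) (S n) = S.sqnorm n"
    using S.ip_orth_le[of "P n" n] by (simp add: S_eq P_eq)
  moreover have "L (P n * S n) = J.sqnorm n"
    using J.ip_orth_le[of "S n" n] by (simp add: S_eq P_eq mult.commute)
  moreover have "S.sqnorm n \<ge> L (S n * S n)"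
    using point_ip_nonneg[of "S n"] by (simp add: S.sqnorm_def sobolev_ip_eq S_eq)
  moreover have "L (S n * S n) \<ge> J.sqnorm n"
    by (rule J.sqnorm_le) (simp_all add: S_eq)
  ultimately have "point_ip (P n) (S n) \<ge> 0"
    by (simp add: sobolev_ip_eq)
  then show ?thesis
    unfolding B using h_pos[of "n - 1"] by simp
qed

lemma W_top: "deg_le [:1, 0, -1 :: real:] 2" "icoeff [:1, 0, -1 :: real:] 2 = -1"
proof -
  show "deg_le [:1, 0, -1 :: real:] 2"
    using deg_le_degree[of "[:1, 0, -1 :: real:]" 2] by simp
  show "icoeff [:1, 0, -1 :: real:] 2 = -1"
    by (simp add: icoeff_def numeral_2_eq_2)
qed

lemma hat_top:
  assumes "n \<ge> 1"
  shows "deg_le (a_hat \<alpha> \<beta> n) 1" "icoeff (a_hat \<alpha> \<beta> n) 1 = - real n"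
    and "deg_le (c_hat \<alpha> \<beta> n) 1" "icoeff (c_hat \<alpha> \<beta> n) 1 = real n + \<alpha> + \<beta>"
proof -
  have "2 * real n + \<alpha> + \<beta> > 0"
    using assms alpha beta by simp
  moreover have "deg_le [:x, y:] 1" for x y :: real
    using deg_le_degree[of "[:x, y:]" 1] by simp
  ultimately show "deg_le (a_hat \<alpha> \<beta> n) 1" "icoeff (a_hat \<alpha> \<beta> n) 1 = - real n"
    "deg_le (c_hat \<alpha> \<beta> n) 1" "icoeff (c_hat \<alpha> \<beta> n) 1 = real n + \<alpha> + \<beta>"
    unfolding a_hat_def c_hat_def by (auto simp: icoeff_smult intro!: deg_le_smult) (auto simp: icoeff_def)
qed

lemma A3_top:
  assumes "n \<ge> 1"
  shows "deg_le (A3 \<alpha> \<beta> N d lam c n) (D + 1)" "icoeff (A3 \<alpha> \<beta> N d lam c n) (D + 1) = - D - real n"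
proof -
  note A' = deg_le_pderiv[OF A2_top(1)[of n]]
  show "deg_le (A3 \<alpha> \<beta> N d lam c n) (D + 1)"
    unfolding A3_def
    by (intro deg_le_add deg_le_smult deg_le_mult[OF W_top(1) A'] deg_le_mult[OF hat_top(1)[OF assms] A2_top(1)]
        deg_le_mono[OF B2_top]) auto
  have "icoeff ([:1, 0, -1:] * pderiv (A2 \<alpha> \<beta> N d lam c n)) (D + 1) = - D"
    by (subst icoeff_mult[OF W_top(1) A']) (simp_all add: W_top A2_top icoeff_pderiv)
  moreover have "icoeff (a_hat \<alpha> \<beta> n * A2 \<alpha> \<beta> N d lam c n) (D + 1) = - real n"
    by (subst icoeff_mult[OF hat_top(1)[OF assms] A2_top(1)]) (simp_all add: hat_top[OF assms] A2_top)
  moreover have "icoeff (B2 \<alpha> \<beta> N d lam c n) (D + 1) = 0"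
    by (rule icoeff_eq_0[OF B2_top]) simp
  ultimately show "icoeff (A3 \<alpha> \<beta> N d lam c n) (D + 1) = - D - real n"
    unfolding A3_def icoeff_add icoeff_smult by simp
qed

text \<open>The derivative contributes \<open>1 - D\<close> times the top coefficient of
  \<open>B2\<close>, where the sign comes from \<open>1 - x^2\<close>; \<open>b_hat\<close> comes
  from the monic \<open>A2\<close>.\<close>

lemma B3_top:
  assumes "n \<ge> 1"
  shows "deg_le (B3 \<alpha> \<beta> N d lam c n) D"
    and "icoeff (B3 \<alpha> \<beta> N d lam c n) D = b_hat \<alpha> \<beta> n + (real n + \<alpha> + \<beta> - D + 1) * B2_top_coeff n"
proof -
  note B' = deg_le_pderiv[OF B2_top[of n]]
  show "deg_le (B3 \<alpha> \<beta> N d lam c n) D"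
    unfolding B3_def
    by (intro deg_le_add deg_le_smult deg_le_mult[OF W_top(1) B'] deg_le_mult[OF hat_top(3)[OF assms] B2_top] A2_top) auto
  have "icoeff ([:1, 0, -1:] * pderiv (B2 \<alpha> \<beta> N d lam c n)) D = (1 - D) * B2_top_coeff n"
    using icoeff_mult[OF W_top(1) B', of D] icoeff_pderiv[of "B2 \<alpha> \<beta> N d lam c n" "D - 1"]
    unfolding W_top B2_top_coeff_def by (simp add: algebra_simps)
  moreover have "icoeff (c_hat \<alpha> \<beta> n * B2 \<alpha> \<beta> N d lam c n) D = (real n + \<alpha> + \<beta>) * B2_top_coeff n"
    by (subst icoeff_mult[OF hat_top(3)[OF assms] B2_top]) (simp_all add: hat_top[OF assms] B2_top_coeff_def)
  ultimately show "icoeff (B3 \<alpha> \<beta> N d lam c n) D = b_hat \<alpha> \<beta> n + (real n + \<alpha> + \<beta> - D + 1) * B2_top_coeff n"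
    unfolding B3_def icoeff_add icoeff_smult by (simp add: A2_top algebra_simps)
qed

lemma linear_top: "deg_le [:a, 1 :: real:] 1" "icoeff [:a, 1 :: real:] 1 = 1"
  using deg_le_degree[of "[:a, 1:]" 1] by (simp_all add: icoeff_def)

lemma C2_top: "deg_le (C2 \<alpha> \<beta> N d lam c n) (D - 1)"
  unfolding C2_def by (intro deg_le_uminus deg_le_smult B2_top)

lemma D2_top:
  "deg_le (D2 \<alpha> \<beta> N d lam c n) D"
  "icoeff (D2 \<alpha> \<beta> N d lam c n) D = 1 + B2_top_coeff (n - 1) / gamma2 \<alpha> \<beta> (n - 1)"
proof -
  show "deg_le (D2 \<alpha> \<beta> N d lam c n) D"
    unfolding D2_def
    by (intro deg_le_add deg_le_smult A2_top deg_le_mult[OF B2_top linear_top(1)]) auto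
  show "icoeff (D2 \<alpha> \<beta> N d lam c n) D = 1 + B2_top_coeff (n - 1) / gamma2 \<alpha> \<beta> (n - 1)"
    unfolding D2_def icoeff_add icoeff_smult A2_top
    by (subst icoeff_mult[OF B2_top linear_top(1)]) (simp_all add: linear_top B2_top_coeff_def)
qed

lemma C3_top: "n \<ge> 2 \<Longrightarrow> deg_le (C3 \<alpha> \<beta> N d lam c n) D"
  unfolding C3_def by (intro deg_le_uminus deg_le_smult B3_top) auto

lemma D3_top: "n \<ge> 2 \<Longrightarrow> deg_le (D3 \<alpha> \<beta> N d lam c n) (D + 1)"
  unfolding D3_def
  by (intro deg_le_add deg_le_smult A3_top deg_le_mult[OF B3_top(1) linear_top(1)]) auto

text \<open>The product of \<open>C2\<close> and \<open>B2\<close> stays below degree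
  \<open>2 * D\<close>, so the top coefficient is that of \<open>D2\<close>.\<close>

lemma Delta_top:
  "deg_le (Delta \<alpha> \<beta> N d lam c n) (2 * D)"
  "icoeff (Delta \<alpha> \<beta> N d lam c n) (2 * D) = 1 + B2_top_coeff (n - 1) / gamma2 \<alpha> \<beta> (n - 1)"
proof -
  have CB: "deg_le (C2 \<alpha> \<beta> N d lam c n * B2 \<alpha> \<beta> N d lam c n) (2 * D - 1)"
    by (intro deg_le_mult[OF C2_top B2_top]) auto
  then show "deg_le (Delta \<alpha> \<beta> N d lam c n) (2 * D)"
    unfolding Delta_def by (intro deg_le_diff deg_le_mult[OF A2_top(1) D2_top(1)]) (auto elim: deg_le_mono)
  show "icoeff (Delta \<alpha> \<beta> N d lam c n) (2 * D) = 1 + B2_top_coeff (n - 1) / gamma2 \<alpha> \<beta> (n - 1)"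
    unfolding Delta_def icoeff_diff icoeff_mult[OF A2_top(1) D2_top(1) mult_2] icoeff_eq_0[OF CB, of "2 * D", simplified]
    by (simp add: A2_top D2_top)
qed

lemma Delta_top_coeff_pos: "n \<ge> 2 \<Longrightarrow> icoeff (Delta \<alpha> \<beta> N d lam c n) (2 * D) > 0"
  unfolding Delta_top using B2_top_coeff_nonneg[of "n - 1"] gamma2_pos[of "n - 2"]
  by (auto intro!: add_pos_nonneg simp: numeral_2_eq_2 Suc_diff_Suc)

text \<open>Degrees add in \<open>Delta = rho * delta\<close> once \<open>Delta\<close> is known to
  be nonzero, which its positive top coefficient guarantees.\<close>

lemma delta_top:
  assumes "n \<ge> 2"
  shows "deg_le (delta \<alpha> \<beta> N d lam c n) D"
proof -
  obtain m where n: "n = Suc (Suc m)"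
    using assms by (metis add_2_eq_Suc le_Suc_ex)
  have nz: "Delta \<alpha> \<beta> N d lam c n \<noteq> 0"
    using Delta_top_coeff_pos[OF assms] by (auto simp: icoeff_def)
  have "degree (Delta \<alpha> \<beta> N d lam c n) \<le> 2 * total_d N d"
    using Delta_top(1)[of n] by (intro degree_le_of_deg_le) simp
  moreover have "degree (Delta \<alpha> \<beta> N d lam c n) = total_d N d + degree (delta \<alpha> \<beta> N d lam c n)"
    using nz unfolding n Delta_eq by (subst degree_mult_eq) (auto simp: degree_R)
  ultimately show ?thesis
    by (intro deg_le_degree) simp
qed

lemma q0_top:
  "deg_le (q0 \<alpha> \<beta> N d lam c n) (2 * D + 2)"
  "icoeff (q0 \<alpha> \<beta> N d lam c n) (2 * D + 2) = - icoeff (Delta \<alpha> \<beta> N d lam c n) (2 * D)"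
proof -
  show "deg_le (q0 \<alpha> \<beta> N d lam c n) (2 * D + 2)"
    unfolding q0_def by (intro deg_le_mult[OF W_top(1) Delta_top(1)]) auto
  show "icoeff (q0 \<alpha> \<beta> N d lam c n) (2 * D + 2) = - icoeff (Delta \<alpha> \<beta> N d lam c n) (2 * D)"
    unfolding q0_def by (subst icoeff_mult[OF W_top(1) Delta_top(1)]) (simp_all add: W_top)
qed

text \<open>The contributions of \<open>D\<close> from \<open>A3\<close> and \<open>B3\<close>
  cancel, which leaves a factor of \<open>B2_top_coeff\<close> that is positive independently of the
  mass points.\<close>

lemma q1_top:
  assumes "n \<ge> 1"
  shows "deg_le (q1 \<alpha> \<beta> N d lam c n) (2 * D)"
    and "icoeff (q1 \<alpha> \<beta> N d lam c n) (2 * D)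
      = b_hat \<alpha> \<beta> n + (2 * real n + \<alpha> + \<beta> + 1) * B2_top_coeff n"
proof -
  show "deg_le (q1 \<alpha> \<beta> N d lam c n) (2 * D)"
    unfolding q1_def
    by (intro deg_le_diff deg_le_mult[OF B3_top(1)[OF assms] A2_top(1)] deg_le_mult[OF A3_top(1)[OF assms] B2_top]) auto
  have "icoeff (A3 \<alpha> \<beta> N d lam c n * B2 \<alpha> \<beta> N d lam c n) (2 * D) = (- D - real n) * B2_top_coeff n"
    by (subst icoeff_mult[OF A3_top(1)[OF assms] B2_top]) (simp_all add: A3_top[OF assms] B2_top_coeff_def)
  then show "icoeff (q1 \<alpha> \<beta> N d lam c n) (2 * D)
      = b_hat \<alpha> \<beta> n + (2 * real n + \<alpha> + \<beta> + 1) * B2_top_coeff n"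
    unfolding q1_def icoeff_diff icoeff_mult[OF B3_top(1)[OF assms] A2_top(1) mult_2]
    by (simp add: B3_top[OF assms] A2_top algebra_simps)
qed

lemma q1_top_coeff_pos:
  assumes "n \<ge> 1"
  shows "icoeff (q1 \<alpha> \<beta> N d lam c n) (2 * D) > 0"
proof -
  obtain m where n: "n = Suc m"
    using assms by (cases n) auto
  have "b_hat \<alpha> \<beta> n > 0"
    unfolding n J.b_hat_eq using J.rec_b_pos[of "Suc m"] alpha beta by simp
  moreover have "2 * real n + \<alpha> + \<beta> + 1 > 0"
    using alpha beta assms by simp
  ultimately show ?thesis
    unfolding q1_top(2)[OF assms] using B2_top_coeff_nonneg[of n] by (simp add: add_pos_nonneg)
qed

lemma q_deg_le:
  assumes "n \<ge> 2"
  shows "deg_le (q2 \<alpha> \<beta> N d lam c n) (2 * D + 1)" "deg_le (q3 \<alpha> \<beta> N d lam c n) (2 * D + 1)"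
    "deg_le (q4 \<alpha> \<beta> N d lam c n) (2 * D)"
proof -
  have n: "n \<ge> 1" using assms by simp
  have "deg_le ([:1, 0, -1:] * pderiv R) (D + 1)"
    by (intro deg_le_mult[OF W_top(1) deg_le_pderiv[OF deg_le_R]]) auto
  then have R: "deg_le ([:1, 0, -1:] * pderiv R * delta \<alpha> \<beta> N d lam c n) (2 * D + 1)"
    by (intro deg_le_mult[OF _ delta_top[OF assms]]) auto
  show "deg_le (q2 \<alpha> \<beta> N d lam c n) (2 * D + 1)"
    unfolding q2_def
    by (intro deg_le_diff deg_le_add R deg_le_mult[OF B3_top(1)[OF n] C2_top] deg_le_mult[OF A3_top(1)[OF n] D2_top(1)]) auto
  show "deg_le (q3 \<alpha> \<beta> N d lam c n) (2 * D + 1)"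
    unfolding q3_def
    by (intro deg_le_diff deg_le_add R deg_le_mult[OF C3_top[OF assms] B2_top] deg_le_mult[OF D3_top[OF assms] A2_top(1)]) auto
  show "deg_le (q4 \<alpha> \<beta> N d lam c n) (2 * D)"
    unfolding q4_def
    by (intro deg_le_diff deg_le_mult[OF C3_top[OF assms] D2_top(1)] deg_le_mult[OF D3_top[OF assms] C2_top]) auto
qed

text \<open>The degree of \<open>ode_P2\<close> is exact because the top coefficients of
  \<open>q1\<close> and \<open>q0\<close> are nonzero. In the other two, all summands obey the same
  bound, since each derivative lowers its bound by one.\<close>

lemma ode_degrees:
  assumes "n \<ge> 2"
  shows "degree (ode_P2 \<alpha> \<beta> N d lam c n) = 6 * total_d N d + 4"
    and "degree (ode_P1 \<alpha> \<beta> N d lam c n) \<le> 6 * total_d N d + 3"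
    and "degree (ode_P0 \<alpha> \<beta> N d lam c n) \<le> 6 * total_d N d + 2"
proof -
  have n: "n \<ge> 1" using assms by simp
  note q0 = q0_top(1)[of n] and q1 = q1_top(1)[OF n] and q = q_deg_le[OF assms]
  note q0' = deg_le_pderiv[OF q0] and q1' = deg_le_pderiv[OF q1] and q2' = deg_le_pderiv[OF q(1)]
  have q00: "deg_le ((q0 \<alpha> \<beta> N d lam c n)\<^sup>2) (4 * D + 4)"
    unfolding power2_eq_square by (intro deg_le_mult[OF q0 q0]) auto
  have "deg_le (ode_P2 \<alpha> \<beta> N d lam c n) (6 * D + 4)"
    unfolding ode_P2_def by (intro deg_le_mult[OF q1 q00]) auto
  moreover have "icoeff (ode_P2 \<alpha> \<beta> N d lam c n) (6 * D + 4)
      = icoeff (q1 \<alpha> \<beta> N d lam c n) (2 * D) * (icoeff (q0 \<alpha> \<beta> N d lam c n) (2 * D + 2))\<^sup>2"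
    unfolding ode_P2_def
    by (subst icoeff_mult[OF q1 q00]) (auto simp: power2_eq_square icoeff_mult[OF q0 q0])
  moreover have "\<dots> \<noteq> 0"
    using q1_top_coeff_pos[OF n] Delta_top_coeff_pos[OF assms] by (simp add: q0_top)
  ultimately show "degree (ode_P2 \<alpha> \<beta> N d lam c n) = 6 * total_d N d + 4"
    by (intro degree_eq_of_icoeff) simp_all
  have "deg_le (q1 \<alpha> \<beta> N d lam c n * q2 \<alpha> \<beta> N d lam c n + q1 \<alpha> \<beta> N d lam c n * q3 \<alpha> \<beta> N d lam c n
      + pderiv (q0 \<alpha> \<beta> N d lam c n) * q1 \<alpha> \<beta> N d lam c n - q0 \<alpha> \<beta> N d lam c n * pderiv (q1 \<alpha> \<beta> N d lam c n)) (4 * D + 1)"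
    by (intro deg_le_diff deg_le_add deg_le_mult[OF q1 q(1)] deg_le_mult[OF q1 q(2)] deg_le_mult[OF q0' q1]
        deg_le_mult[OF q0 q1']) auto
  then have "deg_le (ode_P1 \<alpha> \<beta> N d lam c n) (6 * D + 3)"
    unfolding ode_P1_def by (intro deg_le_mult[OF q0]) auto
  then show "degree (ode_P1 \<alpha> \<beta> N d lam c n) \<le> 6 * total_d N d + 3"
    by (intro degree_le_of_deg_le) simp
  have q12: "deg_le (q1 \<alpha> \<beta> N d lam c n * q2 \<alpha> \<beta> N d lam c n) (4 * D + 1)"
    by (intro deg_le_mult[OF q1 q(1)]) auto
  have wr: "deg_le (pderiv (q2 \<alpha> \<beta> N d lam c n) * q1 \<alpha> \<beta> N d lam c n
      - q2 \<alpha> \<beta> N d lam c n * pderiv (q1 \<alpha> \<beta> N d lam c n)) (4 * D)"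
    by (intro deg_le_diff deg_le_mult[OF q2' q1] deg_le_mult[OF q(1) q1']) auto
  have q11: "deg_le ((q1 \<alpha> \<beta> N d lam c n)\<^sup>2) (4 * D)"
    unfolding power2_eq_square by (intro deg_le_mult[OF q1 q1]) auto
  have "deg_le (ode_P0 \<alpha> \<beta> N d lam c n) (6 * D + 2)"
    unfolding ode_P0_def
    by (intro deg_le_diff deg_le_add deg_le_mult[OF q12 q(2)] deg_le_mult[OF q0 wr] deg_le_mult[OF q(3) q11]) auto
  then show "degree (ode_P0 \<alpha> \<beta> N d lam c n) \<le> 6 * total_d N d + 2"
    by (intro degree_le_of_deg_le) (simp add: add.commute)
qed

end
theorem theorem2:
  fixes \<alpha> \<beta> :: real
    and N n :: nat
    and d :: "nat \<Rightarrow> nat"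
    and lam :: "nat \<Rightarrow> nat \<Rightarrow> real"
    and c :: "nat \<Rightarrow> real"
  assumes "\<alpha> > -1" and "\<beta> > -1"
    and "\<And>j k. j \<in> {1..N} \<Longrightarrow> k \<le> d j \<Longrightarrow> lam j k \<ge> 0"
    and "\<And>j. j \<in> {1..N} \<Longrightarrow> c j \<notin> {-1<..<1}"
    and "inj_on c {1..N}"
    and "\<And>j. j \<in> {1..N} \<Longrightarrow> (j, d j) \<in> Iplus N d lam"
    and "mono_on {1..N} d"
    and "n \<ge> 2"
  shows "(\<forall>x. poly (ode_P2 \<alpha> \<beta> N d lam c n) x *
                poly (pderiv (pderiv (sobolev_poly \<alpha> \<beta> N d lam c n))) x
            + poly (ode_P1 \<alpha> \<beta> N d lam c n) x *
                poly (pderiv (sobolev_poly \<alpha> \<beta> N d lam c n)) x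
            + poly (ode_P0 \<alpha> \<beta> N d lam c n) x *
                poly (sobolev_poly \<alpha> \<beta> N d lam c n) x = 0)
       \<and> degree (ode_P2 \<alpha> \<beta> N d lam c n) = 6 * total_d N d + 4
       \<and> degree (ode_P1 \<alpha> \<beta> N d lam c n) \<le> 6 * total_d N d + 3
       \<and> degree (ode_P0 \<alpha> \<beta> N d lam c n) \<le> 6 * total_d N d + 2"

proof -
  interpret jacobi_sobolev \<alpha> \<beta> N d lam c
    by unfold_locales (use assms in auto)
  obtain m where n: "n = Suc (Suc m)"
    using \<open>n \<ge> 2\<close> by (metis add_2_eq_Suc le_Suc_ex)
  have "\<forall>x. poly (ode_P2 \<alpha> \<beta> N d lam c n) x * poly (pderiv (pderiv (S n))) x
      + poly (ode_P1 \<alpha> \<beta> N d lam c n) x * poly (pderiv (S n)) x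
      + poly (ode_P0 \<alpha> \<beta> N d lam c n) x * poly (S n) x = 0"
    unfolding n using arg_cong[OF ode[of m], of poly] by (simp add: fun_eq_iff)
  with ode_degrees[OF \<open>n \<ge> 2\<close>] show ?thesis
    by blast
qed

end
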